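(* Let $\delta\in[1,2]$. Then there exists a (mixed) labyrinth fractal $L_\infty$ (i.e. the limit set generated by some sequence of labyrinth patterns) with the property that every two distinct exits of $L_\infty$ are connected in $L_\infty$ by an arc whose box counting dimension equals $\delta$.
   Context: **Patterns and limit sets.** For $m\ge1$ and $0\le i,j\le m-1$ let $S_{i,j,m}=[\frac im,\frac{i+1}m]\times[\frac jm,\frac{j+1}m]$ (column $i$, row $j$) and $\mathcal{S}_m=\{S_{i,j,m}: 0\le i,j\le m-1\}$. A nonempty $\mathcal{A}\subseteq\mathcal{S}_m$ is an $m$-pattern of width $m$; its elements are called white squares. For a square $Q=[x,x+q]\times[y,y+q]\subseteq[0,1]^2$ let $P_Q(z_x,z_y)=(qz_x+x,qz_y+y)$. Given a sequence of patterns $\{\mathcal{A}_k\}_{k\ge1}$ of widths $m_k$, put $m(n)=\prod_{k=1}^n m_k$, $\mathcal{W}_1=\mathcal{A}_1$, and $\mathcal{W}_n=\{P_{W'}(W): W\in\mathcal{A}_n, W'\in\mathcal{W}_{n-1}\}\subseteq\mathcal{S}_{m(n)}$ for $n\ge2$ (white squares of level $n$); $L_n=\bigcup_{W\in\mathcal{W}_n}W$ and $L_\infty=\bigcap_{n\ge1}L_n$. **Labyrinth patterns.** The graph $\mathcal{G}(\mathcal{A})$ has the white squares of $\mathcal{A}$ as vertices, two being adjacent iff they share a common side. A vertical exit pair of $\mathcal{A}$ consists of two white squares in the same column, one in the top row (the top exit), the other in the bottom row (the bottom exit); a horizontal exit pair (left exit, right exit) consists of two white squares in the same row, one in the left and one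 in the right column. An $m$-pattern with $m\ge3$ is a labyrinth pattern if: (1) $\mathcal{G}(\mathcal{A})$ is a tree; (2) $\mathcal{A}$ has exactly one vertical and exactly one horizontal exit pair; (3) if a corner square of the $m\times m$ grid is white, then the diagonally opposite corner square is not white. If all $\mathcal{A}_k$ are labyrinth patterns, $L_\infty$ is called a mixed labyrinth fractal (self-similar if all $\mathcal{A}_k$ are equal). It is known that then every $\mathcal{W}_n$ (as an $m(n)$-pattern) also satisfies (1)–(3), and that $L_\infty$ is a dendrite, so any two distinct points of $L_\infty$ are connected by a unique arc in $L_\infty$. **Exits of the fractal.** Let $T_n$ be the top exit of $\mathcal{W}_n$. The top exit of $L_\infty$ is the point in $\bigcap_{n\ge1}T_n$; the bottom, left and right exits of $L_\infty$ are defined analogously. *)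

theory Defs
  imports "HOL-Analysis.Analysis"
begin

(* A square S_{i,j,m} of the m x m grid is represented by its pair of indices (i, j):
   column i (from the left), row j (from the bottom). A pattern is a set of such pairs;
   its width m is always carried along as a separate argument. *)

type_synonym cell = "nat \<times> nat"

definition square :: "nat \<Rightarrow> cell \<Rightarrow> (real \<times> real) set" where
  "square m c =
     {real (fst c) / real m .. (real (fst c) + 1) / real m} \<times>
     {real (snd c) / real m .. (real (snd c) + 1) / real m}"

definition pattern :: "nat \<Rightarrow> cell set \<Rightarrow> bool" where
  "pattern m A \<longleftrightarrow> m \<ge> 1 \<and> A \<noteq> {} \<and> A \<subseteq> {..<m} \<times> {..<m}"


(* The affine map P_Q for Q = [x, x+q] x [y, y+q]. *)

definition P_map :: "real \<Rightarrow> real \<Rightarrow> real \<Rightarrow> real \<times> real \<Rightarrow> real \<times> real" where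
  "P_map x y q z = (q * fst z + x, q * snd z + y)"

abbreviation P_square :: "nat \<Rightarrow> cell \<Rightarrow> real \<times> real \<Rightarrow> real \<times> real" where
  "P_square m c \<equiv> P_map (real (fst c) / real m) (real (snd c) / real m) (1 / real m)"

(* In terms of indices, the image of the cell (i, j) of the m x m grid under P_Q, where
   Q = (i', j') is a cell of a coarser grid; see square_subcell below. *)

definition subcell :: "nat \<Rightarrow> cell \<Rightarrow> cell \<Rightarrow> cell" where
  "subcell m c' c = (fst c' * m + fst c, snd c' * m + snd c)"

lemma square_subcell:
  assumes "m' > 0" "m > 0"
  shows "square (m' * m) (subcell m c' c) = P_square m' c' ` square m c"
proof -
  have aux: "(\<lambda>t. 1 / real m' * t + real a' / real m') ` {real a / real m .. (real a + 1) / real m}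
      = {real (a' * m + a) / real (m' * m) .. (real (a' * m + a) + 1) / real (m' * m)}" for a' a
  proof -
    have "(\<lambda>t. 1 / real m' * t + real a' / real m') ` {real a / real m .. (real a + 1) / real m}
        = {1 / real m' * (real a / real m) + real a' / real m' ..
           1 / real m' * ((real a + 1) / real m) + real a' / real m'}"
      using assms by (subst image_affinity_atLeastAtMost) (auto simp: divide_simps)
    also have "1 / real m' * (real a / real m) + real a' / real m'
        = real (a' * m + a) / real (m' * m)"
      using assms by (simp add: field_simps)
    also have "1 / real m' * ((real a + 1) / real m) + real a' / real m'
        = (real (a' * m + a) + 1) / real (m' * m)"
      using assms by (simp add: field_simps)
    finally show ?thesis .
  qed
  have "P_square m' c' =
      map_prod (\<lambda>t. 1 / real m' * t + real (fst c') / real m')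
               (\<lambda>t. 1 / real m' * t + real (snd c') / real m')"
    by (auto simp: P_map_def fun_eq_iff)
  then show ?thesis
    unfolding square_def subcell_def fst_conv snd_conv
    by (simp only: map_prod_surj_on[OF aux aux])
qed


(* A sequence of patterns is given by A k of width m k for k >= 1; the values at 0 are irrelevant.
   Level 0 is the unit square. *)

definition level_width :: "(nat \<Rightarrow> nat) \<Rightarrow> nat \<Rightarrow> nat" where
  "level_width m n = (\<Prod>k = 1..n. m k)"

primrec white :: "(nat \<Rightarrow> nat) \<Rightarrow> (nat \<Rightarrow> cell set) \<Rightarrow> nat \<Rightarrow> cell set" where
  "white m A 0 = {(0, 0)}"
| "white m A (Suc n) = {subcell (m (Suc n)) c' c |c' c. c' \<in> white m A n \<and> c \<in> A (Suc n)}"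

lemma white_1: "white m A 1 = A 1"
  by (auto simp: subcell_def)

lemma squares_white_Suc:
  assumes "\<And>k. k \<ge> 1 \<Longrightarrow> m k > 0"
  shows "square (level_width m (Suc n)) ` white m A (Suc n) =
    {P_square (level_width m n) c' ` square (m (Suc n)) c |c' c.
       c' \<in> white m A n \<and> c \<in> A (Suc n)}"
proof -
  have lw: "level_width m (Suc n) = level_width m n * m (Suc n)"
    by (simp add: level_width_def)
  have "level_width m n > 0"
    using assms by (auto simp: level_width_def intro!: prod_pos)
  then have "square (level_width m (Suc n)) (subcell (m (Suc n)) c' c) =
      P_square (level_width m n) c' ` square (m (Suc n)) c" for c' c
    unfolding lw using assms by (intro square_subcell) auto
  then show ?thesis
    unfolding white.simps image_Collect by fastforce
qed

definition level_set :: "(nat \<Rightarrow> nat) \<Rightarrow> (nat \<Rightarrow> cell set) \<Rightarrow> nat \<Rightarrow> (real \<times> real) set" where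
  "level_set m A n = (\<Union>c\<in>white m A n. square (level_width m n) c)"

definition limit_set :: "(nat \<Rightarrow> nat) \<Rightarrow> (nat \<Rightarrow> cell set) \<Rightarrow> (real \<times> real) set" where
  "limit_set m A = (\<Inter>n\<in>{1..}. level_set m A n)"


(* Two cells share a common side. *)

definition adjacent :: "cell \<Rightarrow> cell \<Rightarrow> bool" where
  "adjacent c d \<longleftrightarrow>
     fst c = fst d \<and> (snd d = snd c + 1 \<or> snd c = snd d + 1) \<or>
     snd c = snd d \<and> (fst d = fst c + 1 \<or> fst c = fst d + 1)"

definition graph_connected :: "cell set \<Rightarrow> bool" where
  "graph_connected A \<longleftrightarrow>
     (\<forall>c\<in>A. \<forall>d\<in>A. (c, d) \<in> {(x, y). x \<in> A \<and> y \<in> A \<and> adjacent x y}\<^sup>*)"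

(* Cycles of an undirected simple graph, hence of length at least 3: walking an edge back and
   forth is not a cycle, unlike in the symmetric digraphs of Graph_Theory. *)

definition graph_cycle :: "cell set \<Rightarrow> cell list \<Rightarrow> bool" where
  "graph_cycle A xs \<longleftrightarrow>
     length xs \<ge> 3 \<and> distinct xs \<and> set xs \<subseteq> A \<and>
     successively adjacent xs \<and> adjacent (last xs) (hd xs)"

definition graph_tree :: "cell set \<Rightarrow> bool" where
  "graph_tree A \<longleftrightarrow> A \<noteq> {} \<and> graph_connected A \<and> (\<nexists>xs. graph_cycle A xs)"

definition vertical_exit_pair :: "nat \<Rightarrow> cell set \<Rightarrow> cell \<times> cell \<Rightarrow> bool" where
  "vertical_exit_pair m A p \<longleftrightarrow> (case p of (t, b) \<Rightarrow>
     t \<in> A \<and> b \<in> A \<and> fst t = fst b \<and> snd t = m - 1 \<and> snd b = 0)"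

definition horizontal_exit_pair :: "nat \<Rightarrow> cell set \<Rightarrow> cell \<times> cell \<Rightarrow> bool" where
  "horizontal_exit_pair m A p \<longleftrightarrow> (case p of (l, r) \<Rightarrow>
     l \<in> A \<and> r \<in> A \<and> snd l = snd r \<and> fst l = 0 \<and> fst r = m - 1)"

definition labyrinth_pattern :: "nat \<Rightarrow> cell set \<Rightarrow> bool" where
  "labyrinth_pattern m A \<longleftrightarrow>
     pattern m A \<and> m \<ge> 3 \<and>
     graph_tree A \<and>
     (\<exists>!p. vertical_exit_pair m A p) \<and> (\<exists>!p. horizontal_exit_pair m A p) \<and>
     \<not> ((0, 0) \<in> A \<and> (m - 1, m - 1) \<in> A) \<and> \<not> ((0, m - 1) \<in> A \<and> (m - 1, 0) \<in> A)"


datatype side = Top | Bottom | Left | Right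

(* Only meaningful if the pattern has unique exit pairs. *)

definition exit_cell :: "nat \<Rightarrow> cell set \<Rightarrow> side \<Rightarrow> cell" where
  "exit_cell m A s = (case s of
     Top \<Rightarrow> fst (THE p. vertical_exit_pair m A p)
   | Bottom \<Rightarrow> snd (THE p. vertical_exit_pair m A p)
   | Left \<Rightarrow> fst (THE p. horizontal_exit_pair m A p)
   | Right \<Rightarrow> snd (THE p. horizontal_exit_pair m A p))"

definition fractal_exit :: "(nat \<Rightarrow> nat) \<Rightarrow> (nat \<Rightarrow> cell set) \<Rightarrow> side \<Rightarrow> real \<times> real" where
  "fractal_exit m A s = (THE p. p \<in> (\<Inter>n\<in>{1..}.
     square (level_width m n) (exit_cell (level_width m n) (white m A n) s)))"


(* The smallest number of sets of diameter at most e that cover F. Boundedness is required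
   explicitly since diameter is unspecified on unbounded sets. *)

definition covering_number :: "'a::metric_space set \<Rightarrow> real \<Rightarrow> nat" where
  "covering_number F e = (LEAST n. \<exists>C. finite C \<and> card C = n \<and> F \<subseteq> \<Union>C \<and>
     (\<forall>U\<in>C. bounded U \<and> diameter U \<le> e))"

(* The box counting dimension of F exists and equals d. Meant for nonempty totally bounded F. *)

definition has_box_dimension :: "'a::metric_space set \<Rightarrow> real \<Rightarrow> bool" where
  "has_box_dimension F d \<longleftrightarrow>
     ((\<lambda>e. ln (real (covering_number F e)) / (- ln e)) \<longlongrightarrow> d) (at_right 0)"

end

theory Submission
  imports Defs "HOL-Real_Asymp.Real_Asymp"
begin

text \<open>
  All patterns have the same shape: an odd grid whose white squares form four arms of equal
  length, which start in the central cell and end in the middle cells of the four sides, and which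
  are rotations of each other. No other cell on the frame of the grid is white.

  Equal arms make the counting trivial. A path between two exits of a pattern consists of two
  arms and the centre, hence of the same number \<open>N\<close> of cells whichever exits are chosen.
  To refine a path, every cell of it is replaced by a path between the two sides through which it is
  entered and left, and this again takes \<open>N\<close> cells of the finer pattern, be it straight or bent.
  So the path between any two exits at level \<open>n\<close> has exactly \<open>P n\<close> cells, the product of the
  numbers \<open>N\<close> of the first \<open>n\<close> patterns (\<open>route_refine\<close>, \<open>route_trail\<close>).

  The arc sends \<open>x\<close> to the point common to the squares number \<open>\<lfloor>P n * x\<rfloor>\<close> of the level
  \<open>n\<close> paths. It is continuous because consecutive squares of a path are adjacent and small.
  It is injective because squares that are not consecutive on the path are not adjacent, hence meet
  in a corner at most, and corners of squares are not in the fractal: a white square of the next level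
  that contains such a point would come from a corner cell of the next pattern, and those are not
  white (\<open>grid_point_not_in_level_set\<close>).

  The arc is covered by the \<open>P n\<close> squares of its path of level \<open>n\<close> and meets all of
  them, and a set as small as a square meets a bounded number of squares. So its covering number is
  \<open>P n\<close> up to a constant factor at scale \<open>1 / M n\<close>, where \<open>M n\<close> is the width of level
  \<open>n\<close>, and the dimension is the limit of \<open>ln (P n) / ln (M n)\<close>, provided that the widths do
  not grow too fast from one level to the next (\<open>has_box_dimension_grid\<close>).

  It remains to find, for every \<open>k\<close>, arms such that \<open>N\<close> is the power \<open>\<delta>\<close> of the width
  up to a constant factor. A serpentine that fills a rectangle of width about \<open>4 * q\<close> and height
  \<open>h\<close> has about \<open>2 * q * h\<close> cells, and the rectangle fits between its neighbours for all
  \<open>h \<le> 4 * q\<close> (\<open>four_serpentine_arms\<close>). With \<open>q = 2 ^ k\<close> and \<open>h\<close> about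
  \<open>q powr (\<delta> - 1)\<close> the constant factors contribute \<open>O(n)\<close> to the logarithms of \<open>P n\<close> and
  \<open>M n\<close>, which are of order \<open>n\<^sup>2\<close>, and disappear in the limit (\<open>ln_prod_asymp\<close>).
\<close>

section \<open>Cells and subcells of a grid\<close>

fun opposite :: "side \<Rightarrow> side" where
  "opposite Top = Bottom"
| "opposite Bottom = Top"
| "opposite Left = Right"
| "opposite Right = Left"

fun neighbour :: "side \<Rightarrow> cell \<Rightarrow> cell \<Rightarrow> bool" where
  "neighbour Top c d \<longleftrightarrow> fst d = fst c \<and> snd d = snd c + 1"
| "neighbour Bottom c d \<longleftrightarrow> fst d = fst c \<and> snd c = snd d + 1"
| "neighbour Left c d \<longleftrightarrow> snd d = snd c \<and> fst c = fst d + 1"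
| "neighbour Right c d \<longleftrightarrow> snd d = snd c \<and> fst d = fst c + 1"

fun on_side :: "nat \<Rightarrow> side \<Rightarrow> cell \<Rightarrow> bool" where
  "on_side m Top c \<longleftrightarrow> snd c + 1 = m"
| "on_side m Bottom c \<longleftrightarrow> snd c = 0"
| "on_side m Left c \<longleftrightarrow> fst c = 0"
| "on_side m Right c \<longleftrightarrow> fst c + 1 = m"

fun middle :: "nat \<Rightarrow> side \<Rightarrow> cell" where
  "middle m Top = (m div 2, m - 1)"
| "middle m Bottom = (m div 2, 0)"
| "middle m Left = (0, m div 2)"
| "middle m Right = (m - 1, m div 2)"

lemma opposite_opposite [simp]: "opposite (opposite s) = s"
  by (cases s) auto

lemma adjacent_iff_neighbour: "adjacent c d \<longleftrightarrow> (\<exists>s. neighbour s c d)"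
proof -
  have "(\<exists>s. neighbour s c d) \<longleftrightarrow>
      neighbour Top c d \<or> neighbour Bottom c d \<or> neighbour Left c d \<or> neighbour Right c d"
    by (metis side.exhaust)
  then show ?thesis by (auto simp: adjacent_def)
qed

lemma adjacent_sym: "adjacent c d \<longleftrightarrow> adjacent d c"
  by (auto simp: adjacent_def)

lemma adjacent_irrefl [simp]: "\<not> adjacent c c"
  by (auto simp: adjacent_def)

lemma neighbour_opposite: "neighbour (opposite s) c d \<longleftrightarrow> neighbour s d c"
  by (cases s) auto

lemma neighbour_functional: "neighbour s c d \<Longrightarrow> neighbour s c d' \<Longrightarrow> d = d'"
  by (cases s) (auto simp: prod_eq_iff)

lemma neighbour_injective: "neighbour s c d \<Longrightarrow> neighbour s c' d \<Longrightarrow> c = c'"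
  using neighbour_functional[of "opposite s" d c c'] by (simp add: neighbour_opposite)

lemma on_side_no_neighbour: "on_side m s c \<Longrightarrow> neighbour s c d \<Longrightarrow> d \<notin> {..<m} \<times> {..<m}"
  by (cases s) auto

lemma on_side_middle: "m > 0 \<Longrightarrow> on_side m s (middle m s)"
  by (cases s) auto

lemma middle_inj: "m \<ge> 3 \<Longrightarrow> middle m s = middle m t \<longleftrightarrow> s = t"
  by (cases s; cases t) auto

text \<open>For odd widths the middle of a side of the refined grid lies in the middle of the coarse side, so
the exits of all levels have the same closed form.\<close>

lemma middle_mult:
  assumes "odd m" "m' > 0"
  shows "middle (m * m') s = subcell m' (middle m s) (middle m' s)"
proof -
  obtain p where p: "m = 2 * p + 1" using assms oddE by blast
  have "m * m' div 2 = m div 2 * m' + m' div 2"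
  proof -
    have "m * m' = m' + 2 * (p * m')" by (simp add: p algebra_simps)
    then have "m * m' div 2 = m' div 2 + p * m'" by simp
    then show ?thesis using p by simp
  qed
  moreover have "m * m' - 1 = (m - 1) * m' + (m' - 1)"
    using assms p by (simp add: algebra_simps)
  ultimately show ?thesis by (cases s) (auto simp: subcell_def)
qed

text \<open>Cell coordinates of a refined grid are two-digit numbers in base \<open>m\<close>; the next two lemmas
are uniqueness of the digits, and incrementing with a possible carry.\<close>

lemma digits_unique:
  assumes eq: "a * m + e = b * m + f" and "e < m" "f < (m::nat)"
  shows "a = b" "e = f"
proof -
  have "(a * m + e) div m = a" "(b * m + f) div m = b" using assms(2,3) by auto
  with eq show "a = b" by metis
  with eq show "e = f" by simp
qed

lemma digits_unique_Suc:
  assumes "b * m + f = a * m + e + 1" "e < m" "f < (m::nat)"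
  shows "(a = b \<and> f = e + 1) \<or> (b = a + 1 \<and> e + 1 = m \<and> f = 0)"
proof (cases "e + 1 < m")
  case True
  have "b * m + f = a * m + (e + 1)" using assms by simp
  from digits_unique[OF this] True assms show ?thesis by auto
next
  case False
  then have "e + 1 = m" using assms by simp
  then have "b * m + f = (a + 1) * m + 0" using assms by (simp add: algebra_simps)
  from digits_unique[OF this] \<open>e + 1 = m\<close> assms show ?thesis by auto
qed

lemma subcell_inj:
  assumes "subcell m c e = subcell m c' e'"
    and "e \<in> {..<m} \<times> {..<m}" "e' \<in> {..<m} \<times> {..<m}"
  shows "c = c'" "e = e'"
  using assms digits_unique[of "fst c" m "fst e" "fst c'" "fst e'"]
    digits_unique[of "snd c" m "snd e" "snd c'" "snd e'"]
  by (auto simp: subcell_def prod_eq_iff)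

lemma subcell_in_grid:
  assumes "c \<in> {..<m} \<times> {..<m}" "e \<in> {..<m'} \<times> {..<m'}"
  shows "subcell m' c e \<in> {..<m * m'} \<times> {..<m * m'}"
proof -
  have *: "a * m' + b < m * m'" if "a < m" "b < m'" for a b
  proof -
    have "a * m' + b < Suc a * m'" using that by simp
    also have "\<dots> \<le> m * m'" using that by (intro mult_right_mono) auto
    finally show ?thesis .
  qed
  show ?thesis using assms by (auto simp: subcell_def mem_Times_iff intro!: *)
qed

lemma neighbour_subcell_same:
  "neighbour s e e' \<Longrightarrow> neighbour s (subcell m c e) (subcell m c e')"
  by (cases s) (auto simp: subcell_def)

lemma neighbour_subcell_middle:
  "m > 0 \<Longrightarrow> neighbour s c c' \<Longrightarrow>
     neighbour s (subcell m c (middle m s)) (subcell m c' (middle m (opposite s)))"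
  by (cases s) (auto simp: subcell_def algebra_simps)

text \<open>The only way to step out of a coarse cell is through the side that it shares with the next coarse
cell. This is how adjacency in a refined grid is reduced to adjacency in the two factors.\<close>

lemma neighbour_subcellD:
  assumes "neighbour s (subcell m c e) (subcell m c' e')"
    and e: "e \<in> {..<m} \<times> {..<m}" "e' \<in> {..<m} \<times> {..<m}"
  shows "(c = c' \<and> neighbour s e e') \<or>
         (neighbour s c c' \<and> on_side m s e \<and> on_side m (opposite s) e')"
proof -
  have b: "fst e < m" "snd e < m" "fst e' < m" "snd e' < m" using e by auto
  show ?thesis
  proof (cases s)
    case Top
    then show ?thesis
      using assms(1) b digits_unique[of "fst c'" m "fst e'" "fst c" "fst e"]
        digits_unique_Suc[of "snd c'" m "snd e'" "snd c" "snd e"]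
      by (auto simp: subcell_def prod_eq_iff)
  next
    case Bottom
    then show ?thesis
      using assms(1) b digits_unique[of "fst c'" m "fst e'" "fst c" "fst e"]
        digits_unique_Suc[of "snd c" m "snd e" "snd c'" "snd e'"]
      by (auto simp: subcell_def prod_eq_iff)
  next
    case Left
    then show ?thesis
      using assms(1) b digits_unique[of "snd c'" m "snd e'" "snd c" "snd e"]
        digits_unique_Suc[of "fst c" m "fst e" "fst c'" "fst e'"]
      by (auto simp: subcell_def prod_eq_iff)
  next
    case Right
    then show ?thesis
      using assms(1) b digits_unique[of "snd c'" m "snd e'" "snd c" "snd e"]
        digits_unique_Suc[of "fst c'" m "fst e'" "fst c" "fst e"]
      by (auto simp: subcell_def prod_eq_iff)
  qed
qed

lemma on_side_subcellD:
  assumes "on_side (m * m') s (subcell m' c e)"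
    and c: "c \<in> {..<m} \<times> {..<m}" and e: "e \<in> {..<m'} \<times> {..<m'}"
  shows "on_side m s c \<and> on_side m' s e"
proof -
  have b: "fst e < m'" "snd e < m'" "fst c < m" "snd c < m" using e c by auto
  have *: "a + 1 = m \<and> x + 1 = m'" if "a * m' + x + 1 = m * m'" "a < m" "x < m'" for a x
    using digits_unique_Suc[of m m' 0 a x] that by auto
  show ?thesis using assms(1) b *[of "fst c" "fst e"] *[of "snd c" "snd e"]
    by (cases s) (auto simp: subcell_def)
qed

section \<open>Routes and their refinement\<close>

text \<open>The sides through which a path enters and leaves a cell are stored along with the cell, since they
select the finer path that replaces the cell.\<close>

datatype visit = Visit (visited: cell) (entry: side) (leaving: side)

text \<open>The last conjunct says that a route has no shortcuts: it is an induced path of the cell graph.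
In a tree this would hold for every path; stating it here makes it available by induction on the
level, without first proving that the refined patterns are trees.\<close>

definition route :: "nat \<Rightarrow> cell set \<Rightarrow> nat \<Rightarrow> side \<Rightarrow> side \<Rightarrow> (nat \<Rightarrow> visit) \<Rightarrow> bool" where
  "route m W N s t v \<longleftrightarrow>
     N > 0 \<and> (\<forall>j<N. visited (v j) \<in> W) \<and> (\<forall>j<N. entry (v j) \<noteq> leaving (v j)) \<and>
     entry (v 0) = s \<and> visited (v 0) = middle m s \<and>
     leaving (v (N - 1)) = t \<and> visited (v (N - 1)) = middle m t \<and>
     (\<forall>j. Suc j < N \<longrightarrow> neighbour (leaving (v j)) (visited (v j)) (visited (v (Suc j))) \<and>
        entry (v (Suc j)) = opposite (leaving (v j))) \<and>
     inj_on (\<lambda>j. visited (v j)) {..<N} \<and>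
     (\<forall>j<N. \<forall>k<N. adjacent (visited (v j)) (visited (v k)) \<longrightarrow> j = Suc k \<or> k = Suc j)"

lemma route_adjacentD:
  "route m W N s t v \<Longrightarrow> j < N \<Longrightarrow> k < N \<Longrightarrow> adjacent (visited (v j)) (visited (v k)) \<Longrightarrow>
     j = Suc k \<or> k = Suc j"
  unfolding route_def by blast

definition refine :: "nat \<Rightarrow> nat \<Rightarrow> (side \<Rightarrow> side \<Rightarrow> nat \<Rightarrow> visit) \<Rightarrow> (nat \<Rightarrow> visit) \<Rightarrow> nat \<Rightarrow> visit" where
  "refine m N w v j =
    (let x = v (j div N); y = w (entry x) (leaving x) (j mod N)
     in Visit (subcell m (visited x) (visited y)) (entry y) (leaving y))"

lemma refine_simps:
  "visited (refine m N w v j) = subcell m (visited (v (j div N)))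
     (visited (w (entry (v (j div N))) (leaving (v (j div N))) (j mod N)))"
  "entry (refine m N w v j) = entry (w (entry (v (j div N))) (leaving (v (j div N))) (j mod N))"
  "leaving (refine m N w v j) = leaving (w (entry (v (j div N))) (leaving (v (j div N))) (j mod N))"
  by (simp_all add: refine_def Let_def)

text \<open>Digits in base \<open>N'\<close> say which coarse cell is being crossed and where in it. A refined route is
again induced, because the pattern touches each side of a coarse cell in one cell only: two cells
in different coarse cells can be adjacent only if they are the last cell of one crossing and the
first cell of the next.\<close>

lemma route_refine:
  assumes v: "route m W N s t v" and m: "odd m"
    and w: "\<And>s t. s \<noteq> t \<Longrightarrow> route m' A N' s t (w s t)"
    and A: "A \<subseteq> {..<m'} \<times> {..<m'}" and m': "m' > 0"
    and side: "\<And>s e. e \<in> A \<Longrightarrow> on_side m' s e \<Longrightarrow> e = middle m' s"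
  shows "route (m * m') {subcell m' c e |c e. c \<in> W \<and> e \<in> A} (N * N') s t (refine m' N' w v)"
proof -
  have N: "N > 0" using v by (simp add: route_def)
  have N': "N' > 0" using w[of Top Bottom] by (simp add: route_def)
  define c where "c j = visited (v j)" for j
  define u where "u j = w (entry (v j)) (leaving (v j))" for j
  have ne: "entry (v j) \<noteq> leaving (v j)" if "j < N" for j
    using v that by (simp add: route_def)
  have u: "route m' A N' (entry (v j)) (leaving (v j)) (u j)" if "j < N" for j
    using w ne that by (simp add: u_def)
  have r: "visited (refine m' N' w v j) = subcell m' (c (j div N')) (visited (u (j div N') (j mod N')))"
     "entry (refine m' N' w v j) = entry (u (j div N') (j mod N'))"
     "leaving (refine m' N' w v j) = leaving (u (j div N') (j mod N'))" for j
    by (simp_all add: refine_simps c_def u_def)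
  have dm: "j div N' < N" "j mod N' < N'" if "j < N * N'" for j
    using that N' by (auto simp: less_mult_imp_div_less)
  have uA: "visited (u i j) \<in> A" if "i < N" "j < N'" for i j
    using u[OF that(1)] that by (simp add: route_def)
  have grid: "visited (u i j) \<in> {..<m'} \<times> {..<m'}" if "i < N" "j < N'" for i j
    using uA[OF that] A by blast
  have cN: "neighbour (leaving (v j)) (c j) (c (Suc j)) \<and> entry (v (Suc j)) = opposite (leaving (v j))"
    if "Suc j < N" for j
    using v that by (simp add: route_def c_def)
  have cadj: "j = Suc k \<or> k = Suc j" if "j < N" "k < N" "adjacent (c j) (c k)" for j k
    using v that by (simp add: route_def c_def)
  have cinj: "j = k" if "c j = c k" "j < N" "k < N" for j k
  proof -
    have "inj_on c {..<N}" using v by (simp add: route_def c_def[abs_def])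
    then show ?thesis using that by (auto dest: inj_onD)
  qed
  have uinj: "j = k" if "visited (u i j) = visited (u i k)" "i < N" "j < N'" "k < N'" for i j k
  proof -
    have "inj_on (\<lambda>j. visited (u i j)) {..<N'}" using u[OF that(2)] by (simp add: route_def)
    then show ?thesis using that by (auto dest: inj_onD)
  qed
  have uadj: "j = Suc k \<or> k = Suc j"
    if "i < N" "j < N'" "k < N'" "adjacent (visited (u i j)) (visited (u i k))" for i j k
    using u[OF that(1)] that by (simp add: route_def)
  have ufirst: "visited (u i 0) = middle m' (entry (v i))" "entry (u i 0) = entry (v i)" if "i < N" for i
    using u[OF that] by (simp_all add: route_def)
  have ulast: "visited (u i (N' - 1)) = middle m' (leaving (v i))"
     "leaving (u i (N' - 1)) = leaving (v i)" if "i < N" for i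
    using u[OF that] by (simp_all add: route_def)
  have ends: "c 0 = middle m s" "c (N - 1) = middle m t" "entry (v 0) = s" "leaving (v (N - 1)) = t"
    using v by (simp_all add: route_def c_def)
  have last: "(N * N' - 1) div N' = N - 1" "(N * N' - 1) mod N' = N' - 1"
  proof -
    have *: "N * N' - 1 = (N' - 1) + (N - 1) * N'" using N N' by (cases N) auto
    show "(N * N' - 1) div N' = N - 1" "(N * N' - 1) mod N' = N' - 1"
      using N' by (simp_all only: * div_mult_self1 mod_mult_self1) auto
  qed
  have step: "neighbour (leaving (refine m' N' w v j)) (visited (refine m' N' w v j)) (visited (refine m' N' w v (Suc j)))
      \<and> entry (refine m' N' w v (Suc j)) = opposite (leaving (refine m' N' w v j))"
    if j: "Suc j < N * N'" for j
  proof (cases "Suc (j mod N') = N'")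
    case False
    then have *: "Suc j div N' = j div N'" "Suc j mod N' = Suc (j mod N')"
      by (auto simp: div_Suc mod_Suc)
    have "j div N' < N" "Suc (j mod N') < N'" using dm[OF j] dm[of j] j * by auto
    then show ?thesis unfolding r *
      using u[of "j div N'"] by (auto simp: route_def intro: neighbour_subcell_same)
  next
    case True
    then have *: "Suc j div N' = Suc (j div N')" "Suc j mod N' = 0"
      by (auto simp: div_Suc mod_Suc)
    have d: "Suc (j div N') < N" "j div N' < N" using dm[OF j] * by auto
    have jm: "j mod N' = N' - 1" using True by simp
    show ?thesis unfolding r * jm
      using cN[OF d(1)] ufirst[OF d(1)] ulast[OF d(2)] neighbour_subcell_middle[OF m'] by auto
  qed
  have inj: "j = k" if eq: "visited (refine m' N' w v j) = visited (refine m' N' w v k)"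
    and j: "j < N * N'" and k: "k < N * N'" for j k
  proof -
    note cc = subcell_inj[OF eq[unfolded r] grid[OF dm[OF j]] grid[OF dm[OF k]]]
    have d: "j div N' = k div N'" using cinj[OF cc(1)] dm j k by blast
    then have "j mod N' = k mod N'" using uinj cc(2) dm[OF j] dm[OF k] by metis
    with d show ?thesis by (metis div_mult_mod_eq)
  qed
  (* Crossing between two different coarse cells is possible only through the middle of their
     common side, and the fine route visits that cell only when it leaves or enters. *)
  have cross: "k = Suc j" if nb: "neighbour d (visited (refine m' N' w v j)) (visited (refine m' N' w v k))"
    and j: "j < N * N'" and k: "k < N * N'" and kj: "k div N' = Suc (j div N')" for j k d
  proof -
    have dj: "j div N' < N" "j mod N' < N'" and dk: "k div N' < N" "k mod N' < N'"
      using dm j k by auto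
    have "c (j div N') \<noteq> c (k div N')" using cinj dj dk kj by fastforce
    then have *: "neighbour d (c (j div N')) (c (k div N'))"
        "on_side m' d (visited (u (j div N') (j mod N')))"
        "on_side m' (opposite d) (visited (u (k div N') (k mod N')))"
      using neighbour_subcellD[OF nb[unfolded r] grid[OF dj] grid[OF dk]] by auto
    have l: "leaving (v (j div N')) = d"
    proof -
      have "neighbour (leaving (v (j div N'))) (c (j div N')) (c (k div N'))"
        using cN[of "j div N'"] dk kj by simp
      with *(1) show ?thesis by (cases d; cases "leaving (v (j div N'))") auto
    qed
    then have e: "entry (v (k div N')) = opposite d" using cN[of "j div N'"] dk kj by simp
    have "visited (u (j div N') (j mod N')) = visited (u (j div N') (N' - 1))"
      using side[OF uA[OF dj] *(2)] ulast[OF dj(1)] l by simp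
    then have "j mod N' = N' - 1" using uinj dj N' by (metis diff_less zero_less_one)
    moreover have "visited (u (k div N') (k mod N')) = visited (u (k div N') 0)"
      using side[OF uA[OF dk] *(3)] ufirst[OF dk(1)] e by simp
    then have "k mod N' = 0" using uinj dk N' by metis
    moreover have "k = k div N' * N' + k mod N'" "j = j div N' * N' + j mod N'" by simp_all
    ultimately show ?thesis using kj N'
      by (metis add.right_neutral add_Suc_right mult_Suc Suc_pred' add.commute)
  qed
  have adj: "j = Suc k \<or> k = Suc j"
    if a: "adjacent (visited (refine m' N' w v j)) (visited (refine m' N' w v k))"
    and j: "j < N * N'" and k: "k < N * N'" for j k
  proof -
    have dj: "j div N' < N" "j mod N' < N'" and dk: "k div N' < N" "k mod N' < N'"
      using dm j k by auto
    obtain d where d: "neighbour d (visited (refine m' N' w v j)) (visited (refine m' N' w v k))"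
      using a adjacent_iff_neighbour by auto
    then have d': "neighbour (opposite d) (visited (refine m' N' w v k)) (visited (refine m' N' w v j))"
      by (simp add: neighbour_opposite)
    show ?thesis
    proof (cases "j div N' = k div N'")
      case True
      from neighbour_subcellD[OF d[unfolded r] grid[OF dj] grid[OF dk]]
      have "neighbour d (visited (u (j div N') (j mod N'))) (visited (u (j div N') (k mod N')))"
        using True adjacent_iff_neighbour[of "c (j div N')" "c (j div N')"] by auto
      then have "j mod N' = Suc (k mod N') \<or> k mod N' = Suc (j mod N')"
        using uadj dj dk adjacent_iff_neighbour by blast
      then show ?thesis using True by (metis add_Suc_right div_mult_mod_eq)
    next
      case False
      then have "c (j div N') \<noteq> c (k div N')" using cinj dj dk by blast
      then have "adjacent (c (j div N')) (c (k div N'))"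
        using neighbour_subcellD[OF d[unfolded r] grid[OF dj] grid[OF dk]] adjacent_iff_neighbour
        by auto
      then show ?thesis using cadj[OF dj(1) dk(1)] cross[OF d j k] cross[OF d' k j] by blast
    qed
  qed
  show ?thesis
    unfolding route_def
  proof (intro conjI allI impI)
    show "inj_on (\<lambda>j. visited (refine m' N' w v j)) {..<N * N'}"
      by (intro inj_onI) (use inj in auto)
  next
    fix j assume j: "j < N * N'"
    have "c (j div N') \<in> W" using v dm[OF j] by (simp add: route_def c_def)
    then show "visited (refine m' N' w v j) \<in> {subcell m' c e |c e. c \<in> W \<and> e \<in> A}"
      unfolding r using uA[OF dm[OF j]] by blast
    show "entry (refine m' N' w v j) \<noteq> leaving (refine m' N' w v j)"
      unfolding r using u[of "j div N'"] dm[OF j] by (simp add: route_def)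
  next
    show "visited (refine m' N' w v 0) = middle (m * m') s"
      unfolding r middle_mult[OF m m'] using ends ufirst[OF N] by simp
    show "entry (refine m' N' w v 0) = s"
      unfolding r using ends ufirst[OF N] by simp
    show "visited (refine m' N' w v (N * N' - 1)) = middle (m * m') t"
      unfolding r middle_mult[OF m m'] last using ends ulast[of "N - 1"] N by simp
    show "leaving (refine m' N' w v (N * N' - 1)) = t"
      unfolding r last using ends ulast[of "N - 1"] N by simp
  qed (use N N' step adj in auto)
qed

lemma vertical_exit_pair_unique:
  assumes "m > 0" and on: "\<And>c u. c \<in> W \<and> on_side m u c \<longleftrightarrow> c = middle m u"
  shows "vertical_exit_pair m W p \<longleftrightarrow> p = (middle m Top, middle m Bottom)"
proof -
  have "vertical_exit_pair m W p \<longleftrightarrow> (fst p \<in> W \<and> on_side m Top (fst p)) \<and>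
      (snd p \<in> W \<and> on_side m Bottom (snd p)) \<and> fst (fst p) = fst (snd p)"
    using assms(1) by (auto simp: vertical_exit_pair_def split: prod.splits)
  also have "\<dots> \<longleftrightarrow> p = (middle m Top, middle m Bottom)"
    unfolding on by (auto simp: prod_eq_iff)
  finally show ?thesis .
qed

lemma horizontal_exit_pair_unique:
  assumes "m > 0" and on: "\<And>c u. c \<in> W \<and> on_side m u c \<longleftrightarrow> c = middle m u"
  shows "horizontal_exit_pair m W p \<longleftrightarrow> p = (middle m Left, middle m Right)"
proof -
  have "horizontal_exit_pair m W p \<longleftrightarrow> (fst p \<in> W \<and> on_side m Left (fst p)) \<and>
      (snd p \<in> W \<and> on_side m Right (snd p)) \<and> snd (fst p) = snd (snd p)"
    using assms(1) by (auto simp: horizontal_exit_pair_def split: prod.splits)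
  also have "\<dots> \<longleftrightarrow> p = (middle m Left, middle m Right)"
    unfolding on by (auto simp: prod_eq_iff)
  finally show ?thesis .
qed

section \<open>Squares of a grid\<close>

lemma mem_square:
  "p \<in> square m c \<longleftrightarrow> real (fst c) / real m \<le> fst p \<and> fst p \<le> (real (fst c) + 1) / real m \<and>
     real (snd c) / real m \<le> snd p \<and> snd p \<le> (real (snd c) + 1) / real m"
  by (cases p) (auto simp: square_def)

lemma compact_square: "compact (square m c)"
  unfolding square_def by (intro compact_Times) auto

lemma square_nonempty: "square m c \<noteq> {}"
proof -
  have "(real (fst c) / real m, real (snd c) / real m) \<in> square m c"
    by (auto simp: mem_square divide_right_mono)
  then show ?thesis by blast
qed

lemma square_subcell_subset:
  assumes "m > 0" "m' > 0" "e \<in> {..<m'} \<times> {..<m'}"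
  shows "square (m * m') (subcell m' c e) \<subseteq> square m c"
proof -
  have *: "real a / m \<le> real (a * m' + b) / real (m * m')"
    "(real (a * m' + b) + 1) / real (m * m') \<le> (real a + 1) / m" if "b < m'" for a b
  proof -
    have b: "real b + 1 \<le> real m'" using that by linarith
    have e: "real c / m = (real c * m') / real (m * m')" for c :: nat using assms(1,2) by simp
    show "real a / m \<le> real (a * m' + b) / real (m * m')"
      unfolding e by (intro divide_right_mono) auto
    have "(real (a * m' + b) + 1) / real (m * m') \<le> (real (Suc a) * m') / real (m * m')"
      using b by (intro divide_right_mono) (auto simp: algebra_simps)
    then show "(real (a * m' + b) + 1) / real (m * m') \<le> (real a + 1) / m"
      using e[of "Suc a"] by (simp add: add.commute)
  qed
  show ?thesis
    using *[of "fst e" "fst c"] *[of "snd e" "snd c"] assms(3)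
    unfolding subset_iff mem_square subcell_def by force
qed

lemma dist_prod_le: "dist p q \<le> dist (fst p) (fst q) + dist (snd p) (snd q)"
  unfolding dist_prod_def by (rule sqrt_sum_squares_le_sum) auto

lemma dist_square_le:
  assumes "m > 0" "p \<in> square m c" "q \<in> square m d" "c = d \<or> adjacent c d"
  shows "dist p q \<le> 4 / m"
proof -
  have *: "dist x y \<le> 2 / real m"
    if "real a / m \<le> x" "x \<le> (real a + 1) / m" "real b / m \<le> y" "y \<le> (real b + 1) / m"
      "a \<le> b + 1" "b \<le> a + 1" for x y :: real and a b :: nat
  proof -
    have "(real a + 1) / m \<le> (real b + 2) / m" "(real b + 1) / m \<le> (real a + 2) / m"
      using that(5,6) by (intro divide_right_mono; simp)+
    then have "x - y \<le> 2 / m" "y - x \<le> 2 / m" using that by (auto simp: add_divide_distrib)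
    then show ?thesis by (auto simp: dist_real_def)
  qed
  have "dist (fst p) (fst q) \<le> 2 / m" "dist (snd p) (snd q) \<le> 2 / m"
    using assms unfolding mem_square adjacent_def
    by (intro *[of "fst c" _ "fst d"] *[of "snd c" _ "snd d"]; auto)+
  with dist_prod_le[of p q] show ?thesis by simp
qed

text \<open>This describes the only contact that the cell graph does not see.\<close>

lemma squares_meet_diagonally:
  assumes "m > 0" "p \<in> square m c" "p \<in> square m d" "c \<noteq> d" "\<not> adjacent c d"
  obtains a b :: nat where "p = (real a / m, real b / m)"
proof -
  have *: "a \<le> b + 1 \<and> b \<le> a + 1 \<and> (a \<noteq> b \<longrightarrow> x = real (max a b) / m)"
    if "real a / m \<le> x" "x \<le> (real a + 1) / m" "real b / m \<le> x" "x \<le> (real b + 1) / m"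
    for x :: real and a b :: nat
  proof -
    have "real a \<le> x * m" "x * m \<le> real a + 1" "real b \<le> x * m" "x * m \<le> real b + 1"
      using that assms(1) by (auto simp: field_simps)
    then have "a \<le> b + 1 \<and> b \<le> a + 1 \<and> (a \<noteq> b \<longrightarrow> x * m = real (max a b))" by linarith
    then show ?thesis using assms(1) by (auto simp: field_simps)
  qed
  note x = *[of "fst c" "fst p" "fst d"] and y = *[of "snd c" "snd p" "snd d"]
  have "fst c \<noteq> fst d \<and> snd c \<noteq> snd d"
    using x y assms unfolding mem_square adjacent_def prod_eq_iff by linarith
  then have "p = (real (max (fst c) (fst d)) / m, real (max (snd c) (snd d)) / m)"
    using x y assms(2,3) unfolding mem_square by (auto simp: prod_eq_iff)
  then show ?thesis by (rule that)
qed

section \<open>Sequences of patterns that meet the frame only in the side middles\<close>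

text \<open>Here \<open>w k s t\<close> is the path from side \<open>s\<close> to side \<open>t\<close> in pattern \<open>k\<close>, and its length
\<open>N k\<close> is the same for all pairs of sides. The assumption \<open>on_side\<close> keeps the frame
of the pattern black apart from the exits; in particular no corner is white.\<close>

locale crossing_patterns =
  fixes m :: "nat \<Rightarrow> nat" and A :: "nat \<Rightarrow> cell set" and N :: "nat \<Rightarrow> nat"
    and w :: "nat \<Rightarrow> side \<Rightarrow> side \<Rightarrow> nat \<Rightarrow> visit"
  assumes width: "k \<ge> 1 \<Longrightarrow> odd (m k) \<and> m k \<ge> 3"
    and in_grid: "k \<ge> 1 \<Longrightarrow> A k \<subseteq> {..<m k} \<times> {..<m k}"
    and on_side: "k \<ge> 1 \<Longrightarrow> e \<in> A k \<Longrightarrow> on_side (m k) s e \<Longrightarrow> e = middle (m k) s"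
    and routes: "k \<ge> 1 \<Longrightarrow> s \<noteq> t \<Longrightarrow> route (m k) (A k) (N k) s t (w k s t)"
begin

abbreviation M :: "nat \<Rightarrow> nat" where "M n \<equiv> level_width m n"

abbreviation W :: "nat \<Rightarrow> cell set" where "W n \<equiv> white m A n"

definition P :: "nat \<Rightarrow> nat" where "P n = (\<Prod>k=1..n. N k)"

lemma M_Suc: "M (Suc n) = M n * m (Suc n)" by (simp add: level_width_def)
lemma P_Suc: "P (Suc n) = P n * N (Suc n)" by (simp add: P_def)

lemma M_odd: "odd (M n)"
proof (induction n)
  case (Suc n) then show ?case using width[of "Suc n"] by (simp add: M_Suc)
qed (simp add: level_width_def)

lemma M_ge: "M n \<ge> 3 ^ n"
proof (induction n)
  case (Suc n)
  then show ?case using width[of "Suc n"] mult_le_mono[of "3^n" "M n" 3 "m (Suc n)"]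
    by (simp add: M_Suc mult.commute)
qed (simp add: level_width_def)

lemma M_pos: "M n > 0"
  using M_odd[of n] odd_pos by blast

lemma mono_M: "mono M"
  unfolding mono_iff_le_Suc
proof
  show "M n \<le> M (Suc n)" for n using width[of "Suc n"] by (simp add: M_Suc)
qed

lemma M_at_top: "filterlim (\<lambda>n. real (M n)) at_top sequentially"
proof (rule filterlim_at_top_mono)
  show "filterlim (\<lambda>n. 3 ^ n :: real) at_top sequentially" by real_asymp
  have "3 ^ n \<le> real (M n)" for n using M_ge[of n] by (metis of_nat_le_iff of_nat_numeral of_nat_power)
  then show "\<forall>\<^sub>F n in sequentially. 3 ^ n \<le> real (M n)" by simp
qed

lemma middle_M_Suc: "middle (M (Suc n)) s = subcell (m (Suc n)) (middle (M n) s) (middle (m (Suc n)) s)"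
  unfolding M_Suc by (rule middle_mult) (use M_odd width[of "Suc n"] in auto)

lemma N_ge: assumes "k \<ge> 1" shows "N k \<ge> 2"
proof -
  have r: "route (m k) (A k) (N k) Top Bottom (w k Top Bottom)" using routes assms by simp
  have "middle (m k) Top \<noteq> middle (m k) Bottom" using middle_inj width[OF assms] by blast
  then have "N k - 1 \<noteq> 0" using r unfolding route_def by metis
  then show ?thesis by simp
qed

lemma P_ge: "P n \<ge> 2 ^ n"
proof (induction n)
  case (Suc n)
  then show ?case using N_ge[of "Suc n"] mult_le_mono[of "2^n" "P n" 2 "N (Suc n)"]
    by (simp add: P_Suc mult.commute)
qed (simp add: P_def)

lemma P_pos: "P n > 0"
  by (rule less_le_trans[OF _ P_ge]) simp

lemma W_in_grid: "W n \<subseteq> {..<M n} \<times> {..<M n}"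
proof (induction n)
  case (Suc n)
  show ?case
  proof
    fix x assume "x \<in> W (Suc n)"
    then obtain c e where *: "x = subcell (m (Suc n)) c e" "c \<in> W n" "e \<in> A (Suc n)" by auto
    have "c \<in> {..<M n} \<times> {..<M n}" "e \<in> {..<m (Suc n)} \<times> {..<m (Suc n)}"
      using *(2,3) Suc in_grid[of "Suc n"] by auto
    then show "x \<in> {..<M (Suc n)} \<times> {..<M (Suc n)}"
      unfolding M_Suc *(1) by (rule subcell_in_grid)
  qed
qed (auto simp: level_width_def)

text \<open>A cell on a side of the grid of level \<open>n\<close> lies in cells on the same side at all coarser
levels, each of which must be a middle cell if it is white. So the exits are nested and unique.\<close>

lemma W_on_side: "c \<in> W n \<Longrightarrow> on_side (M n) s c \<Longrightarrow> c = middle (M n) s"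
proof (induction n arbitrary: c)
  case 0
  then show ?case by (cases s) (auto simp: level_width_def)
next
  case (Suc n)
  then obtain d e where *: "c = subcell (m (Suc n)) d e" "d \<in> W n" "e \<in> A (Suc n)" by auto
  have "d \<in> {..<M n} \<times> {..<M n}" "e \<in> {..<m (Suc n)} \<times> {..<m (Suc n)}"
    using *(2,3) W_in_grid[of n] in_grid[of "Suc n"] by auto
  from on_side_subcellD[OF _ this] Suc.prems(2)
  have "on_side (M n) s d" "on_side (m (Suc n)) s e" unfolding M_Suc *(1) by auto
  then show ?case using Suc.IH[OF *(2)] on_side[OF _ *(3)] middle_M_Suc *(1) by simp
qed

text \<open>Level \<open>0\<close> is the unit square, crossed in a single step from \<open>s\<close> to \<open>t\<close>.\<close>

primrec trail :: "side \<Rightarrow> side \<Rightarrow> nat \<Rightarrow> nat \<Rightarrow> visit" where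
  "trail s t 0 = (\<lambda>_. Visit (0, 0) s t)"
| "trail s t (Suc n) = refine (m (Suc n)) (N (Suc n)) (w (Suc n)) (trail s t n)"

lemma route_trail: "s \<noteq> t \<Longrightarrow> route (M n) (W n) (P n) s t (trail s t n)"
proof (induction n)
  case 0
  have "middle 1 s = (0,0)" for s by (cases s) auto
  with 0 show ?case by (auto simp: route_def level_width_def P_def inj_on_def)
next
  case (Suc n)
  show ?case unfolding M_Suc P_Suc trail.simps white.simps
    by (rule route_refine[OF Suc.IH[OF Suc.prems] M_odd routes in_grid _ on_side])
      (use width[of "Suc n"] in auto)
qed

lemma middle_in_W: "middle (M n) s \<in> W n"
proof -
  obtain t where "s \<noteq> t" by (metis side.distinct(1))
  from route_trail[OF this, of n] show ?thesis unfolding route_def using P_pos by metis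
qed

lemma exit_cell_W:
  assumes "n \<ge> 1"
  shows "exit_cell (M n) (W n) s = middle (M n) s"
proof -
  have M: "M n > 0" by (rule M_pos)
  have on: "c \<in> W n \<and> on_side (M n) u c \<longleftrightarrow> c = middle (M n) u" for c u
    using W_on_side middle_in_W on_side_middle[OF M] by blast
  have v: "vertical_exit_pair (M n) (W n) p \<longleftrightarrow> p = (middle (M n) Top, middle (M n) Bottom)" for p
    by (rule vertical_exit_pair_unique[OF M on])
  have h: "horizontal_exit_pair (M n) (W n) p \<longleftrightarrow> p = (middle (M n) Left, middle (M n) Right)" for p
    by (rule horizontal_exit_pair_unique[OF M on])
  have "vertical_exit_pair (M n) (W n) = (\<lambda>p. p = (middle (M n) Top, middle (M n) Bottom))"
    "horizontal_exit_pair (M n) (W n) = (\<lambda>p. p = (middle (M n) Left, middle (M n) Right))"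
    using v h by blast+
  then show ?thesis by (cases s) (simp_all add: exit_cell_def del: middle.simps)
qed

end

context crossing_patterns
begin

text \<open>A white square of the next level that contains a grid point has a corner there, so its last digits
are those of a corner cell of the pattern, and corner cells are not white.\<close>

lemma grid_point_not_in_level_set:
  "(real a / M n, real b / M n) \<notin> level_set m A (Suc n)"
proof
  let ?k = "Suc n" and ?p = "(real a / M n, real b / M n)"
  assume "?p \<in> level_set m A ?k"
  then obtain c e where c: "c \<in> W n" "e \<in> A ?k" and p: "?p \<in> square (M ?k) (subcell (m ?k) c e)"
    by (auto simp: level_set_def)
  have e: "fst e < m ?k" "snd e < m ?k" using in_grid[of ?k] c by auto
  have m: "m ?k \<ge> 3" using width[of ?k] by simp
  have *: "j = 0 \<or> j + 1 = m ?k"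
    if "real (i * m ?k + j) / M ?k \<le> real a / M n" "real a / M n \<le> (real (i * m ?k + j) + 1) / M ?k"
      "j < m ?k" for i j a
  proof -
    have "real a / M n = real (a * m ?k) / M ?k"
      using m by (simp add: M_Suc)
    then have "real (i * m ?k + j) \<le> real (a * m ?k)" "real (a * m ?k) \<le> real (i * m ?k + j) + 1"
      using that(1,2) M_pos[of ?k] by (simp_all add: divide_le_cancel)
    then have "i * m ?k + j \<le> a * m ?k" "a * m ?k \<le> i * m ?k + j + 1" by linarith+
    then have "a * m ?k + 0 = i * m ?k + j \<or> a * m ?k + 0 = i * m ?k + j + 1" by linarith
    then show ?thesis
      using digits_unique[of a "m ?k" 0 i j] digits_unique_Suc[of a "m ?k" 0 i j] that(3) by auto
  qed
  have "fst e = 0 \<or> fst e + 1 = m ?k" "snd e = 0 \<or> snd e + 1 = m ?k"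
    using p e *[of "fst c" "fst e" a] *[of "snd c" "snd e" b] by (auto simp: mem_square subcell_def)
  then have "e = middle (m ?k) Left \<or> e = middle (m ?k) Right"
    "e = middle (m ?k) Bottom \<or> e = middle (m ?k) Top"
    using on_side[of ?k, OF _ c(2), of Left] on_side[of ?k, OF _ c(2), of Right]
      on_side[of ?k, OF _ c(2), of Top] on_side[of ?k, OF _ c(2), of Bottom] by auto
  then show False using middle_inj[OF m] by (metis side.distinct)
qed

text \<open>The minimum matters at \<open>x = 1\<close> only, where \<open>\<lfloor>P n * x\<rfloor>\<close> is one past the last index.\<close>

definition index :: "nat \<Rightarrow> real \<Rightarrow> nat" where
  "index n x = min (nat \<lfloor>real (P n) * x\<rfloor>) (P n - 1)"

lemma index_less: "index n x < P n"
  using P_pos[of n] by (auto simp: index_def min_def)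

text \<open>Compatibility with the refinement of routes, where the coarse index is obtained by division; it
makes the squares that track a parameter nested.\<close>

lemma index_Suc:
  fixes x :: real
  assumes "x \<in> {0..1}"
  shows "index (Suc n) x div N (Suc n) = index n x"
proof -
  let ?N = "N (Suc n)"
  have N: "?N > 0" using N_ge[of "Suc n"] by simp
  show ?thesis
  proof (cases "x = 1")
    case True
    have *: "P n * ?N - 1 = (?N - 1) + (P n - 1) * ?N" using N P_pos[of n] by (cases "P n") auto
    have "(P n * ?N - 1) div ?N = P n - 1"
      using N by (simp only: * div_mult_self1) auto
    moreover have "index k x = P k - 1" for k using True by (simp add: index_def)
    ultimately show ?thesis by (simp add: P_Suc)
  next
    case False
    then have x: "0 \<le> x" "x < 1" using assms by auto
    have ind: "index k x = nat \<lfloor>P k * x\<rfloor>" for k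
    proof -
      have "P k * x < P k" using x P_pos[of k] by (simp add: mult_less_cancel_left2)
      then have "nat \<lfloor>P k * x\<rfloor> < P k" using x by (simp add: nat_less_iff floor_less_iff)
      then show ?thesis by (simp add: index_def)
    qed
    have "nat \<lfloor>P n * x\<rfloor> = nat \<lfloor>real (P (Suc n)) * x / real ?N\<rfloor>" using N by (simp add: P_Suc)
    also have "\<dots> = nat (\<lfloor>P (Suc n) * x\<rfloor> div int ?N)"
      using floor_divide_real_eq_div[of "int ?N" "P (Suc n) * x"] by simp
    also have "\<dots> = nat \<lfloor>P (Suc n) * x\<rfloor> div ?N"
      using x by (simp add: nat_div_distrib)
    finally show ?thesis by (simp add: ind)
  qed
qed

lemma index_left_endpoint: "j < P n \<Longrightarrow> index n (j / P n) = j"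
  using P_pos[of n] by (simp add: index_def)

lemma index_near:
  fixes x y :: real
  assumes "0 \<le> x" "x \<le> y" "(y - x) * P n < 1"
  shows "index n x = index n y \<or> index n y = Suc (index n x)"
proof -
  let ?i = "nat \<lfloor>P n * x\<rfloor>" and ?j = "nat \<lfloor>P n * y\<rfloor>"
  have "P n * x \<le> P n * y" using assms by (simp add: mult_left_mono)
  moreover have "P n * y < P n * x + 1" using assms by (simp add: algebra_simps)
  moreover have "0 \<le> P n * x" using assms by simp
  ultimately have "\<lfloor>P n * x\<rfloor> \<le> \<lfloor>P n * y\<rfloor>" "\<lfloor>P n * y\<rfloor> \<le> \<lfloor>P n * x\<rfloor> + 1" "0 \<le> \<lfloor>P n * x\<rfloor>"
    by linarith+
  then have "?j = ?i \<or> ?j = Suc ?i" by linarith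
  then show ?thesis unfolding index_def by linarith
qed

lemma index_far:
  fixes x y :: real
  assumes "0 \<le> x" "y \<le> 1" "(y - x) * P n \<ge> 3"
  shows "index n x + 2 \<le> index n y"
proof -
  have "P n * x + 3 \<le> P n * y" using assms by (simp add: algebra_simps)
  moreover have "0 \<le> P n * x" using assms by simp
  moreover have "P n * y \<le> P n" using assms by (simp add: mult_left_le)
  ultimately have "nat \<lfloor>P n * x\<rfloor> + 3 \<le> nat \<lfloor>P n * y\<rfloor>" "nat \<lfloor>P n * y\<rfloor> \<le> P n"
    by linarith+
  then show ?thesis unfolding index_def by linarith
qed

end

section \<open>The arc followed by the refined routes\<close>

locale fractal_route = crossing_patterns +
  fixes s t :: side
  assumes distinct_sides: "s \<noteq> t"
begin

abbreviation trail_cell :: "nat \<Rightarrow> nat \<Rightarrow> cell" where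
  "trail_cell n j \<equiv> visited (trail s t n j)"

abbreviation tracking_square :: "real \<Rightarrow> nat \<Rightarrow> (real \<times> real) set" where
  "tracking_square x n \<equiv> square (M n) (trail_cell n (index n x))"

lemma route_trail': "route (M n) (W n) (P n) s t (trail s t n)"
  by (rule route_trail[OF distinct_sides])

lemma trail_cell_in_W: "j < P n \<Longrightarrow> trail_cell n j \<in> W n"
  using route_trail'[of n] by (simp add: route_def)

lemma trail_cell_inj: "inj_on (trail_cell n) {..<P n}"
  using route_trail'[of n] by (simp add: route_def)

lemma trail_cell_adjacent:
  "Suc j < P n \<Longrightarrow> adjacent (trail_cell n j) (trail_cell n (Suc j))"
  using route_trail'[of n] by (auto simp: route_def adjacent_iff_neighbour)

lemma trail_cell_nonadjacent:
  "j + 2 \<le> k \<Longrightarrow> k < P n \<Longrightarrow> \<not> adjacent (trail_cell n j) (trail_cell n k)"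
proof
  assume *: "j + 2 \<le> k" "k < P n" "adjacent (trail_cell n j) (trail_cell n k)"
  moreover have "j < P n" using * by simp
  ultimately have "j = Suc k \<or> k = Suc j" using route_adjacentD[OF route_trail'] by blast
  then show False using * by auto
qed

lemma trail_square_Suc:
  assumes j: "j < P (Suc n)"
  shows "square (M (Suc n)) (trail_cell (Suc n) j) \<subseteq> square (M n) (trail_cell n (j div N (Suc n)))"
proof -
  let ?k = "Suc n"
  let ?x = "trail s t n (j div N ?k)"
  let ?y = "w ?k (entry ?x) (leaving ?x) (j mod N ?k)"
  have N: "N ?k > 0" using N_ge[of ?k] by simp
  have "j div N ?k < P n" "j mod N ?k < N ?k"
    using j N by (auto simp: P_Suc less_mult_imp_div_less)
  moreover then have "entry ?x \<noteq> leaving ?x" using route_trail'[of n] by (simp add: route_def)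
  ultimately have "visited ?y \<in> A ?k"
    using routes[of ?k "entry ?x" "leaving ?x"] by (auto simp: route_def)
  then have "visited ?y \<in> {..<m ?k} \<times> {..<m ?k}" using in_grid[of ?k] by auto
  then show ?thesis
    unfolding trail.simps refine_simps M_Suc
    using M_pos width[of ?k] by (intro square_subcell_subset) auto
qed

lemma tracking_square_antimono:
  assumes "x \<in> {0..1}"
  shows "decseq (tracking_square x)"
  unfolding decseq_Suc_iff
proof
  fix n
  show "tracking_square x (Suc n) \<subseteq> tracking_square x n"
    using trail_square_Suc[OF index_less[of "Suc n" x]] unfolding index_Suc[OF assms] .
qed

definition \<gamma> :: "real \<Rightarrow> real \<times> real" where
  "\<gamma> x = (SOME p. \<forall>n. p \<in> tracking_square x n)"

lemma \<gamma>_mem: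
  assumes "x \<in> {0..1}"
  shows "\<gamma> x \<in> tracking_square x n"
proof -
  have "\<Inter> (range (tracking_square x)) \<noteq> {}"
    by (rule compact_nest) (use compact_square square_nonempty tracking_square_antimono[OF assms] in
      \<open>auto simp: decseq_def\<close>)
  then have "\<exists>p. \<forall>n. p \<in> tracking_square x n" by auto
  then show ?thesis unfolding \<gamma>_def by (rule someI2_ex) auto
qed

lemma ex_level:
  fixes e :: real
  assumes "e > 0"
  shows "\<exists>n. 4 / M n < e"
proof -
  have "\<forall>\<^sub>F n in sequentially. real (M n) > 4 / e"
    using M_at_top by (simp add: filterlim_at_top_dense)
  then obtain n where "real (M n) > 4 / e" by (auto simp: eventually_sequentially)
  then show ?thesis using assms M_pos[of n] by (intro exI[of _ n]) (simp add: field_simps)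
qed

lemma \<gamma>_continuous: "continuous_on {0..1} \<gamma>"
proof -
  have close: "dist (\<gamma> x) (\<gamma> y) \<le> 4 / M n"
    if "x \<in> {0..1}" "y \<in> {0..1}" "x \<le> y" "(y - x) * P n < 1" for x y :: real and n
  proof (rule dist_square_le[OF M_pos \<gamma>_mem[OF that(1)] \<gamma>_mem[OF that(2)]])
    have "index n x = index n y \<or> index n y = Suc (index n x)"
      by (rule index_near) (use that in auto)
    then show "trail_cell n (index n x) = trail_cell n (index n y) \<or>
        adjacent (trail_cell n (index n x)) (trail_cell n (index n y))"
      using trail_cell_adjacent[of "index n x" n] index_less[of n y] by auto
  qed
  have "uniformly_continuous_on {0..1} \<gamma>"
    unfolding uniformly_continuous_on_def
  proof (intro allI impI)
    fix e :: real assume "e > 0"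
    then obtain n where n: "4 / M n < e" using ex_level by blast
    show "\<exists>d>0. \<forall>x\<in>{0..1}. \<forall>x'\<in>{0..1}. dist x' x < d \<longrightarrow> dist (\<gamma> x') (\<gamma> x) < e"
    proof (intro exI[of _ "1 / P n"] conjI ballI impI)
      fix x y :: real assume xy: "x \<in> {0..1}" "y \<in> {0..1}" "dist y x < 1 / P n"
      have "\<bar>y - x\<bar> * P n < 1" using xy(3) P_pos[of n] by (simp add: dist_real_def field_simps)
      then show "dist (\<gamma> y) (\<gamma> x) < e"
        using close[of x y n] close[of y x n] xy n
        by (cases "x \<le> y") (auto simp: dist_commute)
    qed (use P_pos in auto)
  qed
  then show ?thesis by (rule uniformly_continuous_imp_continuous)
qed

lemma \<gamma>_in_level_set:
  assumes "x \<in> {0..1}"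
  shows "\<gamma> x \<in> level_set m A n"
  using \<gamma>_mem[OF assms, of n] trail_cell_in_W[OF index_less[of n x]] unfolding level_set_def by blast

text \<open>Two parameters are eventually separated by more than one step of the route. Their squares are then
neither equal nor adjacent, so a common point of the two squares would be a grid point.\<close>

lemma \<gamma>_inj: "inj_on \<gamma> {0..1}"
proof -
  have "\<gamma> x \<noteq> \<gamma> y" if x: "x \<in> {0..1}" and y: "y \<in> {0..1}" and "x < y" for x y :: real
  proof
    assume eq: "\<gamma> x = \<gamma> y"
    obtain n :: nat where n: "3 / (y - x) < 2 ^ n"
      using real_arch_pow[of 2 "3 / (y - x)"] by auto
    have "2 ^ n \<le> real (P n)" using P_ge[of n] by (metis of_nat_le_iff of_nat_numeral of_nat_power)
    with n have "3 / (y - x) \<le> P n" by linarith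
    then have "(y - x) * P n \<ge> 3" using \<open>x < y\<close> by (simp add: field_simps)
    then have i: "index n x + 2 \<le> index n y" using x y by (intro index_far) auto
    have "trail_cell n (index n x) \<noteq> trail_cell n (index n y)"
      using inj_onD[OF trail_cell_inj[of n], of "index n x" "index n y"] i index_less by auto
    then obtain a b :: nat where "\<gamma> x = (real a / M n, real b / M n)"
      using squares_meet_diagonally[OF M_pos \<gamma>_mem[OF x]] \<gamma>_mem[OF y, of n]
        trail_cell_nonadjacent[OF i index_less] eq by metis
    then show False using grid_point_not_in_level_set \<gamma>_in_level_set[OF x] by metis
  qed
  then show ?thesis unfolding inj_on_def by (metis linorder_neqE)
qed

lemma arc_\<gamma>: "arc \<gamma>"
  using \<gamma>_continuous \<gamma>_inj by (simp add: arc_def path_def)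

lemma \<gamma>_in_limit_set: "path_image \<gamma> \<subseteq> limit_set m A"
  using \<gamma>_in_level_set by (auto simp: path_image_def limit_set_def)

lemma \<gamma>_ends: "\<gamma> 0 \<in> square (M n) (middle (M n) s)" "\<gamma> 1 \<in> square (M n) (middle (M n) t)"
proof -
  have "index n 0 = 0" "index n 1 = P n - 1" by (simp_all add: index_def)
  moreover have "trail_cell n 0 = middle (M n) s" "trail_cell n (P n - 1) = middle (M n) t"
    using route_trail'[of n] by (simp_all add: route_def)
  ultimately show "\<gamma> 0 \<in> square (M n) (middle (M n) s)" "\<gamma> 1 \<in> square (M n) (middle (M n) t)"
    using \<gamma>_mem[of 0 n] \<gamma>_mem[of 1 n] by simp_all
qed

lemma fractal_exit_eq:
  assumes "\<And>n. p \<in> square (M n) (middle (M n) u)"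
  shows "fractal_exit m A u = p"
proof -
  have "(\<Inter>n\<in>{1..}. square (M n) (exit_cell (M n) (W n) u)) = {p}"
  proof (intro equalityI subsetI)
    fix q assume q: "q \<in> (\<Inter>n\<in>{1..}. square (M n) (exit_cell (M n) (W n) u))"
    have "dist q p \<le> 0"
    proof (rule field_le_epsilon)
      fix e :: real assume "e > 0"
      then obtain n where n: "4 / M n < e" using ex_level by blast
      moreover have "4 / M (Suc n) \<le> 4 / M n"
        using M_pos monoD[OF mono_M, of n "Suc n"] by (intro divide_left_mono) auto
      moreover have "q \<in> square (M (Suc n)) (middle (M (Suc n)) u)"
        using q exit_cell_W[of "Suc n" u] unfolding INT_iff by (metis atLeast_iff le_add1 plus_1_eq_Suc)
      ultimately show "dist q p \<le> 0 + e"
        using dist_square_le[OF M_pos[of "Suc n"] _ assms[of "Suc n"] disjI1[OF refl], of q] by linarith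
    qed
    then show "q \<in> {p}" by simp
  qed (use assms exit_cell_W in auto)
  then show ?thesis by (simp add: fractal_exit_def)
qed

lemma \<gamma>_start: "pathstart \<gamma> = fractal_exit m A s" and \<gamma>_finish: "pathfinish \<gamma> = fractal_exit m A t"
  using fractal_exit_eq[OF \<gamma>_ends(1)] fractal_exit_eq[OF \<gamma>_ends(2)]
  by (simp_all add: pathstart_def pathfinish_def)

lemma \<gamma>_covered: "path_image \<gamma> \<subseteq> (\<Union>c\<in>trail_cell n ` {..<P n}. square (M n) c)"
proof
  fix p assume "p \<in> path_image \<gamma>"
  then obtain x where x: "x \<in> {0..1}" "p = \<gamma> x" by (auto simp: path_image_def)
  have "\<gamma> x \<in> square (M n) (trail_cell n (index n x))" by (rule \<gamma>_mem[OF x(1)])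
  then show "p \<in> (\<Union>c\<in>trail_cell n ` {..<P n}. square (M n) c)"
    using index_less[of n x] x(2) by blast
qed

text \<open>The left end of the \<open>j\<close>-th parameter interval has index \<open>j\<close>, so the arc visits every square
of its trail; this gives the lower bound for the dimension.\<close>

lemma \<gamma>_meets: "c \<in> trail_cell n ` {..<P n} \<Longrightarrow> path_image \<gamma> \<inter> square (M n) c \<noteq> {}"
proof -
  assume "c \<in> trail_cell n ` {..<P n}"
  then obtain j where j: "j < P n" "c = trail_cell n j" by auto
  have *: "real j / P n \<in> {0..1}" using j by auto
  from \<gamma>_mem[OF *, of n] index_left_endpoint[OF j(1)] j
  have "\<gamma> (real j / P n) \<in> square (M n) c" by simp
  moreover have "\<gamma> (real j / P n) \<in> path_image \<gamma>" using * by (auto simp: path_image_def)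
  ultimately show ?thesis by blast
qed

end

section \<open>Box dimension from grids of growing width\<close>

text \<open>Coordinates of two such cells differ by at most \<open>5\<close>: at most \<open>4\<close> widths between the points in
\<open>U\<close>, and one more for the position inside the squares. This gives \<open>11\<^sup>2\<close> cells.\<close>

lemma card_squares_meeting:
  assumes "m > 0" "bounded U" "diameter U \<le> 4 / real m"
  shows "finite {c. square m c \<inter> U \<noteq> {}}" "card {c. square m c \<inter> U \<noteq> {}} \<le> 121"
proof -
  let ?S = "{c. square m c \<inter> U \<noteq> {}}"
  have "finite ?S \<and> card ?S \<le> 121"
  proof (cases "?S = {}")
    case False
    then obtain c p where p: "p \<in> square m c" "p \<in> U" by auto
    have near: "i \<in> {j - 5..j + 5}"
      if "real i / m \<le> x" "x \<le> (real i + 1) / m" "real j / m \<le> y" "y \<le> (real j + 1) / m"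
        "\<bar>x - y\<bar> \<le> 4 / m" for i j :: nat and x y :: real
    proof -
      have "real i \<le> x * m" "x * m \<le> real i + 1" "real j \<le> y * m" "y * m \<le> real j + 1"
        using that assms(1) by (auto simp: field_simps)
      moreover have "\<bar>x - y\<bar> * m \<le> 4" using that(5) assms(1) by (simp add: field_simps)
      then have "\<bar>x * m - y * m\<bar> \<le> 4" using assms(1) by (simp add: abs_mult flip: left_diff_distrib)
      ultimately have "i \<le> j + 5" "j \<le> i + 5" by linarith+
      then show ?thesis by auto
    qed
    have "?S \<subseteq> {fst c - 5..fst c + 5} \<times> {snd c - 5..snd c + 5}"
    proof
      fix d assume "d \<in> ?S"
      then obtain q where q: "q \<in> square m d" "q \<in> U" by auto
      have "dist q p \<le> 4 / m"
        using diameter_bounded_bound[OF assms(2) q(2) p(2)] assms(3) by linarith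
      then have "\<bar>fst q - fst p\<bar> \<le> 4 / m" "\<bar>snd q - snd p\<bar> \<le> 4 / m"
        using dist_fst_le[of q p] dist_snd_le[of q p] by (auto simp: dist_real_def)
      then show "d \<in> {fst c - 5..fst c + 5} \<times> {snd c - 5..snd c + 5}"
        using near p(1) q(1) unfolding mem_square mem_Times_iff by blast
    qed
    moreover have "finite ({fst c - 5..fst c + 5} \<times> {snd c - 5..snd c + 5})" by simp
    moreover have "card ({fst c - 5..fst c + 5} \<times> {snd c - 5..snd c + 5}) \<le> 11 * 11"
      unfolding card_cartesian_product by (intro mult_le_mono) auto
    ultimately have "card ?S \<le> 11 * 11" "finite ?S"
      by (meson card_mono finite_subset le_trans)+
    then show ?thesis by simp
  qed (simp only: finite.emptyI card.empty, simp)
  then show "finite ?S" "card ?S \<le> 121" by auto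
qed

lemma covering_number_grid_bounds:
  assumes "m > 0" "finite D" "F \<subseteq> (\<Union>c\<in>D. square m c)" and e: "4 / real m \<le> e"
  shows "covering_number F e \<le> card D"
    and "\<exists>C. finite C \<and> card C = covering_number F e \<and> F \<subseteq> \<Union>C \<and>
           (\<forall>U\<in>C. bounded U \<and> diameter U \<le> e)"
proof -
  let ?P = "\<lambda>n. \<exists>C. finite C \<and> card C = n \<and> F \<subseteq> \<Union>C \<and> (\<forall>U\<in>C. bounded U \<and> diameter U \<le> e)"
  have "diameter (square m c) \<le> e" for c
  proof (rule diameter_le)
    show "norm (p - q) \<le> e" if "p \<in> square m c" "q \<in> square m c" for p q
      using dist_square_le[OF assms(1) that] e by (simp add: dist_norm)
  qed (use square_nonempty in auto)
  then have P: "?P (card (square m ` D))"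
    using assms by (intro exI[of _ "square m ` D"]) (auto simp: compact_imp_bounded compact_square)
  have "covering_number F e \<le> card (square m ` D)"
    unfolding covering_number_def by (rule Least_le[of ?P, OF P])
  also have "\<dots> \<le> card D" by (rule card_image_le[OF assms(2)])
  finally show "covering_number F e \<le> card D" .
  show "?P (covering_number F e)"
    unfolding covering_number_def by (rule LeastI[of ?P, OF P])
qed

lemma card_grid_le_covering_number:
  assumes C: "finite C" "F \<subseteq> \<Union>C" "\<And>U. U \<in> C \<Longrightarrow> bounded U \<and> diameter U \<le> 4 / real m"
    and D: "m > 0" "finite D" "\<And>c. c \<in> D \<Longrightarrow> F \<inter> square m c \<noteq> {}"
  shows "card D \<le> 121 * card C"
proof -
  let ?S = "\<lambda>U. {c. square m c \<inter> U \<noteq> {}}"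
  have "D \<subseteq> (\<Union>U\<in>C. ?S U)" using C(2) D(3) by fastforce
  moreover have "finite (\<Union>U\<in>C. ?S U)" using C card_squares_meeting(1)[OF D(1)] by blast
  ultimately have "card D \<le> card (\<Union>U\<in>C. ?S U)" by (intro card_mono)
  also have "\<dots> \<le> (\<Sum>U\<in>C. card (?S U))" by (rule card_UN_le[OF C(1)])
  also have "\<dots> \<le> (\<Sum>U\<in>C. 121)"
    by (intro sum_mono card_squares_meeting(2)[OF D(1)]) (use C(3) in auto)
  finally show ?thesis by simp
qed

text \<open>A scale \<open>e\<close> is placed between \<open>4 / M (n + 1)\<close> and \<open>4 / M n\<close>. The squares of level
\<open>n + 1\<close> bound the covering number from above and those of level \<open>n\<close> bound it from below,
and by \<open>ratio\<close> the gap between the two levels does not affect the quotient of logarithms.\<close>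

lemma has_box_dimension_grid:
  fixes M :: "nat \<Rightarrow> nat" and D :: "nat \<Rightarrow> cell set" and F :: "(real \<times> real) set"
  assumes M: "\<And>n. M n > 0" "mono M" "filterlim (\<lambda>n. real (M n)) at_top sequentially"
    and D: "\<And>n. finite (D n)" "\<And>n. D n \<noteq> {}"
    and cover: "\<And>n. F \<subseteq> (\<Union>c\<in>D n. square (M n) c)"
    and meets: "\<And>n c. c \<in> D n \<Longrightarrow> F \<inter> square (M n) c \<noteq> {}"
    and ratio: "(\<lambda>n. ln (real (M (Suc n))) / ln (real (M n))) \<longlonglongrightarrow> 1"
    and dim: "(\<lambda>n. ln (real (card (D n))) / ln (real (M n))) \<longlonglongrightarrow> \<delta>"
  shows "has_box_dimension F \<delta>"
proof -
  define level where "level e = (LEAST n. 4 / real (M (Suc n)) \<le> e)" for e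
  define lower where "lower n = (ln (real (card (D n))) - ln 121) / (ln (real (M (Suc n))) - ln 4)" for n
  define upper where "upper n = ln (real (card (D (Suc n)))) / (ln (real (M n)) - ln 4)" for n
  have lnM: "filterlim (\<lambda>n. ln (real (M n))) at_top sequentially"
    by (rule filterlim_compose[OF ln_at_top M(3)])
  have lnM_ev: "\<forall>\<^sub>F n in sequentially. ln (real (M n)) > ln 4"
    using lnM by (simp add: filterlim_at_top_dense)
  have const: "(\<lambda>n. c / ln (real (M n))) \<longlonglongrightarrow> 0" for c
    by (rule tendsto_divide_0[OF tendsto_const filterlim_at_top_imp_at_infinity[OF lnM]])
  have card_pos: "card (D n) > 0" for n using D by (simp add: card_gt_0_iff)
  have ex_level: "\<exists>n. 4 / real (M (Suc n)) \<le> e" if "e > 0" for e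
  proof -
    have "\<forall>\<^sub>F n in sequentially. real (M n) > 4 / e"
      using M(3) by (simp add: filterlim_at_top_dense)
    then obtain n where n: "real (M n) > 4 / e" by (auto simp: eventually_sequentially)
    have "M n \<le> M (Suc n)" using M(2) by (simp add: monoD)
    with n have "real (M (Suc n)) > 4 / e" by linarith
    then show ?thesis using that M(1)[of "Suc n"] by (intro exI[of _ n]) (simp add: field_simps)
  qed
  have "upper \<longlonglongrightarrow> \<delta>"
  proof (rule Lim_transform_eventually)
    have "(\<lambda>n. ln (real (card (D (Suc n)))) / ln (real (M (Suc n))) * (ln (real (M (Suc n))) / ln (real (M n)))
        / (1 - ln 4 / ln (real (M n)))) \<longlonglongrightarrow> \<delta> * 1 / (1 - 0)"
      by (intro tendsto_intros LIMSEQ_Suc[OF dim] ratio const) auto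
    then show "(\<lambda>n. ln (real (card (D (Suc n)))) / ln (real (M (Suc n))) * (ln (real (M (Suc n))) / ln (real (M n)))
        / (1 - ln 4 / ln (real (M n)))) \<longlonglongrightarrow> \<delta>" by simp
    show "\<forall>\<^sub>F n in sequentially. ln (real (card (D (Suc n)))) / ln (real (M (Suc n))) *
        (ln (real (M (Suc n))) / ln (real (M n))) / (1 - ln 4 / ln (real (M n))) = upper n"
      using lnM_ev eventually_all_ge_at_top[OF lnM_ev]
    proof eventually_elim
      case (elim n)
      have "ln (4 :: real) > 0" by simp
      moreover have "ln (real (M n)) > ln 4" "ln (real (M (Suc n))) > ln 4" using elim by auto
      ultimately have "ln (real (M n)) > 0" "ln (real (M (Suc n))) > 0" by linarith+
      then show ?case using elim by (simp add: upper_def divide_simps)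
    qed
  qed
  moreover have "lower \<longlonglongrightarrow> \<delta>"
  proof (rule Lim_transform_eventually)
    have "(\<lambda>n. (ln (real (card (D n))) / ln (real (M n)) - ln 121 / ln (real (M n)))
        / (ln (real (M (Suc n))) / ln (real (M n)) - ln 4 / ln (real (M n)))) \<longlonglongrightarrow> (\<delta> - 0) / (1 - 0)"
      by (intro tendsto_intros dim ratio const) auto
    then show "(\<lambda>n. (ln (real (card (D n))) / ln (real (M n)) - ln 121 / ln (real (M n)))
        / (ln (real (M (Suc n))) / ln (real (M n)) - ln 4 / ln (real (M n)))) \<longlonglongrightarrow> \<delta>" by simp
    show "\<forall>\<^sub>F n in sequentially. (ln (real (card (D n))) / ln (real (M n)) - ln 121 / ln (real (M n)))
        / (ln (real (M (Suc n))) / ln (real (M n)) - ln 4 / ln (real (M n))) = lower n"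
      using lnM_ev
    proof eventually_elim
      case (elim n)
      have "ln (4 :: real) > 0" by simp
      then have "ln (real (M n)) \<noteq> 0" using elim by linarith
      then show ?case by (simp add: lower_def flip: diff_divide_distrib)
    qed
  qed
  moreover have level: "filterlim level at_top (at_right 0)"
  proof (subst filterlim_at_top, intro allI)
    fix K :: nat
    have "\<forall>\<^sub>F e :: real in at_right 0. e < 4 / M K"
      using M(1)[of K] by (intro eventually_at_rightI[of 0 "4 / M K"]) auto
    then show "\<forall>\<^sub>F e :: real in at_right 0. K \<le> level e"
      using eventually_at_right_less
    proof eventually_elim
      case (elim e)
      show ?case
      proof (rule ccontr)
        assume "\<not> K \<le> level e"
        have "4 / real (M (Suc (level e))) \<le> e"
          unfolding level_def by (rule LeastI_ex[OF ex_level[OF elim(2)]])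
        also have "\<dots> < 4 / M K" by (rule elim(1))
        finally have "M K < M (Suc (level e))" using M(1) by (simp add: field_simps)
        moreover have "M (Suc (level e)) \<le> M K" using \<open>\<not> K \<le> level e\<close> M(2) by (simp add: monoD)
        ultimately show False by simp
      qed
    qed
  qed
  ultimately have lim: "((\<lambda>e. lower (level e)) \<longlongrightarrow> \<delta>) (at_right 0)" "((\<lambda>e. upper (level e)) \<longlongrightarrow> \<delta>) (at_right 0)"
    by (auto intro: filterlim_compose)
  have sandwich: "\<forall>\<^sub>F e in at_right 0. lower (level e) \<le> ln (real (covering_number F e)) / (- ln e) \<and>
      ln (real (covering_number F e)) / (- ln e) \<le> upper (level e)"
  proof -
    have "\<forall>\<^sub>F e in at_right 0. ln (real (M (level e))) > ln 4"
      using lnM_ev level by (rule eventually_compose_filterlim)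
    moreover have "\<forall>\<^sub>F e in at_right 0. level e > 0"
      using eventually_compose_filterlim[OF eventually_gt_at_top level, of 0] .
    moreover have "\<forall>\<^sub>F e :: real in at_right 0. e > 0" by (rule eventually_at_right_less)
    ultimately show ?thesis
    proof eventually_elim
      case (elim e)
      let ?n = "level e" and ?cov = "covering_number F e"
      have ge: "4 / real (M (Suc ?n)) \<le> e"
        unfolding level_def by (rule LeastI_ex[OF ex_level[OF elim(3)]])
      have lt: "e < 4 / real (M ?n)"
      proof -
        have "?n - 1 < ?n" using elim(2) by simp
        then have "\<not> 4 / real (M (Suc (?n - 1))) \<le> e" 
          unfolding level_def by (rule not_less_Least)
        then show ?thesis using elim(2) by simp
      qed
      have ln_lower: "ln (real (M ?n)) - ln 4 \<le> - ln e"
      proof -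
        have "ln e \<le> ln (4 / real (M ?n))" using lt elim(3) M(1)[of ?n] by (subst ln_le_cancel_iff) auto
        then show ?thesis using M(1)[of ?n] by (simp add: ln_div)
      qed
      have ln_upper: "- ln e \<le> ln (real (M (Suc ?n))) - ln 4"
      proof -
        have "ln (4 / real (M (Suc ?n))) \<le> ln e" using ge M(1)[of "Suc ?n"] elim(3) by (subst ln_le_cancel_iff) auto
        then show ?thesis using M(1)[of "Suc ?n"] by (simp add: ln_div)
      qed
      note bounds = covering_number_grid_bounds[OF M(1) D(1) cover ge]
      obtain C where C: "finite C" "card C = ?cov" "F \<subseteq> \<Union>C" "\<forall>U\<in>C. bounded U \<and> diameter U \<le> e"
        using bounds(2) by blast
      have "\<And>U. U \<in> C \<Longrightarrow> bounded U \<and> diameter U \<le> 4 / real (M ?n)"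
        using C(4) lt by fastforce
      from card_grid_le_covering_number[OF C(1,3) this M(1) D(1) meets]
      have le: "card (D ?n) \<le> 121 * ?cov" using C(2) by simp
      have cov: "?cov > 0" using le card_pos[of ?n] by (cases "?cov = 0") auto
      have "ln (real (card (D ?n))) \<le> ln (real (121 * ?cov))"
        using le card_pos[of ?n] cov by (subst ln_le_cancel_iff) (auto simp del: of_nat_mult)
      then have num_lower: "ln (real (card (D ?n))) - ln 121 \<le> ln (real ?cov)"
        using cov by (simp add: ln_mult)
      have num_upper: "ln (real ?cov) \<le> ln (real (card (D (Suc ?n))))"
        using bounds(1) cov by simp
      have num_nonneg: "0 \<le> ln (real ?cov)" using cov by simp
      (* A negative numerator cannot be compared by enlarging the denominator,
         but then the quotient is nonpositive while a covering number is at least 1. *)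
      have "lower ?n \<le> ln (real ?cov) / (- ln e)"
      proof (cases "ln (real (card (D ?n))) - ln 121 \<ge> 0")
        case True
        show ?thesis unfolding lower_def
          by (rule frac_le) (use num_nonneg num_lower ln_lower ln_upper elim(1) in auto)
      next
        case False
        then have "lower ?n \<le> 0"
          unfolding lower_def using ln_lower ln_upper elim(1) by (intro divide_nonpos_pos) auto
        also have "0 \<le> ln (real ?cov) / (- ln e)"
          using num_nonneg ln_lower elim(1) by (intro divide_nonneg_nonneg) auto
        finally show ?thesis .
      qed
      moreover have "ln (real ?cov) / (- ln e) \<le> upper ?n"
        unfolding upper_def
        by (rule frac_le) (use num_nonneg num_upper ln_lower elim(1) in auto)
      ultimately show ?case by blast
    qed
  qed
  show ?thesis
    unfolding has_box_dimension_def
    by (rule tendsto_sandwich[OF _ _ lim])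
      (use sandwich in \<open>auto elim!: eventually_mono\<close>)
qed

section \<open>Patterns made of four arms\<close>

text \<open>A cell of maximal rank on a cycle would have two different neighbours of no larger rank.\<close>

lemma no_cycle_if_ranked:
  fixes rank :: "cell \<Rightarrow> nat"
  assumes "\<And>c d d'. \<lbrakk>c \<in> A; d \<in> A; d' \<in> A; adjacent c d; adjacent c d'; rank d \<le> rank c; rank d' \<le> rank c\<rbrakk> \<Longrightarrow> d = d'"
  shows "\<not> graph_cycle A xs"
proof
  assume cyc: "graph_cycle A xs"
  define n where "n = length xs"
  have n: "n \<ge> 3" and dist: "distinct xs" and A: "set xs \<subseteq> A"
    and succ: "successively adjacent xs" and close: "adjacent (last xs) (hd xs)"
    using cyc by (auto simp: graph_cycle_def n_def)
  have next_adj: "adjacent (xs ! k) (xs ! (Suc k mod n))" if "k < n" for k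
  proof (cases "Suc k < n")
    case True
    then show ?thesis using succ by (simp add: successively_conv_nth n_def)
  next
    case False
    then have k: "k = n - 1" "Suc k = n" using that by auto
    then have "Suc k mod n = 0" by simp
    moreover have "xs \<noteq> []" using n n_def by auto
    ultimately show ?thesis using close k(1) by (simp add: last_conv_nth hd_conv_nth n_def)
  qed
  let ?R = "(\<lambda>k. rank (xs ! k)) ` {..<n}"
  have "Max ?R \<in> ?R" using n by (intro Max_in) (auto simp: lessThan_empty_iff)
  then obtain k where k: "k < n" "rank (xs ! k) = Max ?R" by auto
  have max: "rank (xs ! j) \<le> rank (xs ! k)" if "j < n" for j
    unfolding k(2) using that by (intro Max_ge) auto
  define i where "i = (if k = 0 then n - 1 else k - 1)"
  define j where "j = Suc k mod n"
  have ij: "i < n" "j < n" "i \<noteq> j" "Suc i mod n = k"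
    using k(1) n by (auto simp: i_def j_def mod_Suc)
  have "adjacent (xs ! k) (xs ! i)" "adjacent (xs ! k) (xs ! j)"
    using next_adj[OF ij(1)] next_adj[OF k(1)] ij(4) adjacent_sym by (auto simp: j_def)
  moreover have "xs ! i \<in> A" "xs ! j \<in> A" "xs ! k \<in> A"
    using A ij k(1) by (auto simp: n_def)
  ultimately have "xs ! i = xs ! j" using assms max ij by blast
  then show False using dist ij by (simp add: n_def nth_eq_iff_index_eq)
qed

text \<open>Arms are indexed by the distance \<open>i\<close> from the centre, and \<open>dir s i\<close> is the side through which the
arm of side \<open>s\<close> leaves its cell number \<open>i\<close> on the way outwards. The last two assumptions
say that the arms share the centre only and have no contact other than between consecutive cells.\<close>

locale four_arms =
  fixes m a :: nat and arm :: "side \<Rightarrow> nat \<Rightarrow> cell" and dir :: "side \<Rightarrow> nat \<Rightarrow> side"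
  assumes width: "m \<ge> 3"
    and arm_in_grid: "i \<le> a \<Longrightarrow> arm s i \<in> {..<m} \<times> {..<m}"
    and centre: "arm s 0 = arm t 0"
    and tip: "arm s a = middle m s"
    and dir_first: "dir s 0 = s"
    and dir_last: "dir s a = s"
    and step: "i < a \<Longrightarrow> neighbour (dir s i) (arm s i) (arm s (Suc i))"
    and arm_on_side: "i \<le> a \<Longrightarrow> on_side m d (arm s i) \<Longrightarrow> i = a \<and> d = s"
    and arm_inj: "i \<le> a \<Longrightarrow> j \<le> a \<Longrightarrow> arm s i = arm t j \<Longrightarrow> i = j \<and> (i = 0 \<or> s = t)"
    and arm_adjacent: "i \<le> a \<Longrightarrow> j \<le> a \<Longrightarrow> adjacent (arm s i) (arm t j) \<Longrightarrow>
          (i = Suc j \<or> j = Suc i) \<and> (i = 0 \<or> j = 0 \<or> s = t)"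
begin

definition cells :: "cell set" where "cells = {arm s i |s i. i \<le> a}"

lemma cellsI: "i \<le> a \<Longrightarrow> arm s i \<in> cells"
  by (auto simp: cells_def)

lemma cells_in_grid: "cells \<subseteq> {..<m} \<times> {..<m}"
  using arm_in_grid unfolding cells_def by blast

lemma cells_on_side: "e \<in> cells \<Longrightarrow> on_side m s e \<Longrightarrow> e = middle m s"
  using arm_on_side tip by (auto simp: cells_def)

lemma cells_on_side_iff: "e \<in> cells \<and> on_side m s e \<longleftrightarrow> e = middle m s"
proof -
  have "middle m s \<in> cells" using cellsI[of a s] tip[of s] by simp
  moreover have "on_side m s (middle m s)" using on_side_middle width by simp
  ultimately show ?thesis using cells_on_side by blast
qed

text \<open>The route inside a cell needs two different sides, so an arm must not turn back on the spot. It
cannot do so without visiting a cell twice or leaving the grid.\<close>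

lemma no_u_turn:
  assumes "i < a"
  shows "dir s (Suc i) \<noteq> opposite (dir s i)"
proof
  assume eq: "dir s (Suc i) = opposite (dir s i)"
  have st: "neighbour (dir s i) (arm s i) (arm s (Suc i))" using step assms by blast
  show False
  proof (cases "Suc i < a")
    case True
    from step[OF this, of s] have "neighbour (dir s i) (arm s (Suc (Suc i))) (arm s (Suc i))"
      by (simp add: eq neighbour_opposite)
    with st have "arm s i = arm s (Suc (Suc i))" by (rule neighbour_injective)
    then show False using arm_inj[of i "Suc (Suc i)" s s] True by simp
  next
    case False
    then have "Suc i = a" using assms by simp
    then have "dir s i = opposite s" using eq dir_last[of s] by (metis opposite_opposite)
    then have "neighbour s (middle m s) (arm s i)"
      using st \<open>Suc i = a\<close> tip[of s] by (simp add: neighbour_opposite)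
    then show False
      using on_side_no_neighbour[OF on_side_middle] arm_in_grid[of i s] assms width by force
  qed
qed

lemma graph_connected_cells: "graph_connected cells"
proof -
  let ?E = "{(x, y). x \<in> cells \<and> y \<in> cells \<and> adjacent x y}"
  have centre_arm: "(arm s 0, arm s i) \<in> ?E\<^sup>*" if "i \<le> a" for s i
    using that
  proof (induction i)
    case (Suc i)
    have "(arm s i, arm s (Suc i)) \<in> ?E"
      using Suc.prems step[of i s] by (auto simp: adjacent_iff_neighbour intro: cellsI)
    with Suc show ?case by (meson Suc_leD rtrancl.rtrancl_into_rtrancl)
  qed auto
  have "sym ?E" by (auto simp: sym_def adjacent_sym)
  then have sym: "sym (?E\<^sup>*)" by (rule sym_rtrancl)
  have "(c, d) \<in> ?E\<^sup>*" if "c \<in> cells" "d \<in> cells" for c d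
  proof -
    obtain s i t j where c: "c = arm s i" "i \<le> a" and d: "d = arm t j" "j \<le> a"
      using \<open>c \<in> cells\<close> \<open>d \<in> cells\<close> by (auto simp: cells_def)
    have "(c, arm s 0) \<in> ?E\<^sup>*" using centre_arm[OF c(2), of s] sym c(1) by (auto dest: symD)
    moreover have "(arm s 0, d) \<in> ?E\<^sup>*" using centre_arm[OF d(2), of t] d(1) centre[of s t] by auto
    ultimately show ?thesis by (rule rtrancl_trans)
  qed
  then show ?thesis by (auto simp: graph_connected_def)
qed

text \<open>The distance from the centre along the arm is a rank for which the only neighbour of no larger rank
is the previous cell of the arm.\<close>

lemma no_graph_cycle_cells: "\<not> graph_cycle cells xs"
proof (rule no_cycle_if_ranked)
  define rank where "rank c = (THE i. i \<le> a \<and> (\<exists>s. c = arm s i))" for c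
  have rank: "rank (arm s i) = i" if "i \<le> a" for s i
    unfolding rank_def using that arm_inj by (intro the_equality) blast+
  have parent: "d = arm s (i - 1)"
    if "i \<le> a" "d \<in> cells" "adjacent (arm s i) d" "rank d \<le> rank (arm s i)" for s i d
  proof -
    obtain t j where d: "d = arm t j" "j \<le> a" using \<open>d \<in> cells\<close> by (auto simp: cells_def)
    have "(i = Suc j \<or> j = Suc i) \<and> (i = 0 \<or> j = 0 \<or> s = t)"
      using arm_adjacent that(1,3) d by blast
    moreover have "j \<le> i" using that d rank by simp
    ultimately show ?thesis using d(1) centre[of t s] by auto
  qed
  show "d = d'" if "c \<in> cells" "d \<in> cells" "d' \<in> cells" "adjacent c d" "adjacent c d'"
      "rank d \<le> rank c" "rank d' \<le> rank c" for c d d'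
  proof -
    obtain s i where "c = arm s i" "i \<le> a" using \<open>c \<in> cells\<close> by (auto simp: cells_def)
    then show ?thesis using parent[of i d s] parent[of i d' s] that by simp
  qed
qed

lemma labyrinth_cells: "labyrinth_pattern m cells"
proof -
  have m: "m > 0" using width by simp
  have "pattern m cells"
    using width cells_in_grid cellsI[of 0] by (auto simp: pattern_def)
  moreover have "graph_tree cells"
    using graph_connected_cells no_graph_cycle_cells cellsI[of 0] by (auto simp: graph_tree_def)
  moreover have "\<exists>!p. vertical_exit_pair m cells p" "\<exists>!p. horizontal_exit_pair m cells p"
    using vertical_exit_pair_unique[OF m cells_on_side_iff]
      horizontal_exit_pair_unique[OF m cells_on_side_iff] by auto
  moreover have "c \<notin> cells" if "on_side m s c" "on_side m t c" "s \<noteq> t" for c s t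
    using that cells_on_side middle_inj[OF width] by metis
  from this[of Left "(0, 0)" Bottom] this[of Left "(0, m - 1)" Top]
  have "(0, 0) \<notin> cells" "(0, m - 1) \<notin> cells" using m by auto
  ultimately show ?thesis using width by (simp add: labyrinth_pattern_def)
qed

text \<open>One arm inwards and another one outwards; the arms have length \<open>a\<close>, which makes \<open>2 * a + 1\<close>
cells for every pair of sides.\<close>

definition arm_route :: "side \<Rightarrow> side \<Rightarrow> nat \<Rightarrow> visit" where
  "arm_route s t j =
    (if j < a then Visit (arm s (a - j)) (dir s (a - j)) (opposite (dir s (a - j - 1)))
     else if j = a then Visit (arm s 0) s t
     else Visit (arm t (j - a)) (opposite (dir t (j - a - 1))) (dir t (j - a)))"

lemma arm_length_pos: "a > 0"
proof (rule ccontr)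
  assume "\<not> a > 0"
  then have "middle m Top = middle m Bottom" using tip[of Top] tip[of Bottom] centre[of Top Bottom] by simp
  then show False using middle_inj[OF width] by blast
qed

lemma visited_arm_route:
  "visited (arm_route s t j) = (if j \<le> a then arm s (a - j) else arm t (j - a))"
  by (auto simp: arm_route_def)

lemma route_arm_route:
  assumes "s \<noteq> t"
  shows "route m cells (2 * a + 1) s t (arm_route s t)"
  unfolding route_def
proof (intro conjI allI impI)
  show "0 < 2 * a + 1" by simp
  show "visited (arm_route s t j) \<in> cells" if "j < 2 * a + 1" for j
    using that by (auto simp: visited_arm_route intro: cellsI)
  show "entry (arm_route s t j) \<noteq> leaving (arm_route s t j)" if "j < 2 * a + 1" for j
  proof -
    consider "j < a" | "j = a" | "a < j" by linarith
    then show ?thesis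
    proof cases
      case 1
      then have "a - j = Suc (a - j - 1)" "a - j - 1 < a" by auto
      with no_u_turn[of "a - j - 1" s] 1 show ?thesis by (simp add: arm_route_def)
    next
      case 2 with assms show ?thesis by (simp add: arm_route_def)
    next
      case 3
      then have "j - a = Suc (j - a - 1)" "j - a - 1 < a" using that by auto
      with no_u_turn[of "j - a - 1" t] 3 show ?thesis by (simp add: arm_route_def)
    qed
  qed
  show "entry (arm_route s t 0) = s" "visited (arm_route s t 0) = middle m s"
    "leaving (arm_route s t (2 * a + 1 - 1)) = t" "visited (arm_route s t (2 * a + 1 - 1)) = middle m t"
    using arm_length_pos by (simp_all add: arm_route_def dir_last tip)
  fix j assume j: "Suc j < 2 * a + 1"
  have "neighbour (leaving (arm_route s t j)) (visited (arm_route s t j)) (visited (arm_route s t (Suc j))) \<and>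
      entry (arm_route s t (Suc j)) = opposite (leaving (arm_route s t j))"
  proof -
    consider "j < a" | "j = a" | "a < j" by linarith
    then show ?thesis
    proof cases
      case 1
      then have *: "a - j = Suc (a - Suc j)" "a - Suc j < a" by auto
      have "neighbour (dir s (a - Suc j)) (arm s (a - Suc j)) (arm s (a - j))"
        unfolding *(1) by (rule step[OF *(2)])
      with 1 show ?thesis
        by (cases "Suc j = a") (auto simp: arm_route_def neighbour_opposite dir_first)
    next
      case 2
      with step[of 0 t] arm_length_pos centre[of s t] show ?thesis
        by (auto simp: arm_route_def dir_first)
    next
      case 3
      then have "Suc j - a = Suc (j - a)" "j - a < a" using j by auto
      with step[of "j - a" t] 3 show ?thesis by (auto simp: arm_route_def)
    qed
  qed
  then show "neighbour (leaving (arm_route s t j)) (visited (arm_route s t j)) (visited (arm_route s t (Suc j)))"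
    "entry (arm_route s t (Suc j)) = opposite (leaving (arm_route s t j))" by auto
next
  have aux: False
    if "j \<le> a" "a < k" "k < 2 * a + 1" "arm s (a - j) = arm t (k - a)" for j k
  proof -
    have "a - j = k - a \<and> (a - j = 0 \<or> s = t)" by (rule arm_inj) (use that in auto)
    with that(2) assms show False by auto
  qed
  show "inj_on (\<lambda>j. visited (arm_route s t j)) {..<2 * a + 1}"
  proof (rule inj_onI)
    fix j k assume *: "j \<in> {..<2 * a + 1}" "k \<in> {..<2 * a + 1}"
      "visited (arm_route s t j) = visited (arm_route s t k)"
    consider "j \<le> a" "k \<le> a" | "j \<le> a" "a < k" | "a < j" "k \<le> a" | "a < j" "a < k" by linarith
    then show "j = k"
    proof cases
      case 1
      with * have "a - j = a - k" using arm_inj[of "a - j" "a - k" s s] by (simp add: visited_arm_route)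
      with 1 show ?thesis by linarith
    next
      case 2 with * aux[of j k] show ?thesis by (simp add: visited_arm_route)
    next
      case 3 with * aux[of k j] show ?thesis by (simp add: visited_arm_route)
    next
      case 4
      with * have "j - a = k - a" using arm_inj[of "j - a" "k - a" t t] by (simp add: visited_arm_route)
      with 4 show ?thesis by linarith
    qed
  qed
next
  have aux: "k = Suc j"
    if "j \<le> a" "a < k" "k < 2 * a + 1" "adjacent (arm s (a - j)) (arm t (k - a))" for j k
  proof -
    have "(a - j = Suc (k - a) \<or> k - a = Suc (a - j)) \<and> (a - j = 0 \<or> k - a = 0 \<or> s = t)"
      by (rule arm_adjacent) (use that in auto)
    with that(1,2) assms show "k = Suc j" by auto
  qed
  fix j k assume *: "j < 2 * a + 1" "k < 2 * a + 1"
    "adjacent (visited (arm_route s t j)) (visited (arm_route s t k))"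
  consider "j \<le> a" "k \<le> a" | "j \<le> a" "a < k" | "a < j" "k \<le> a" | "a < j" "a < k" by linarith
  then show "j = Suc k \<or> k = Suc j"
  proof cases
    case 1
    with * have "a - j = Suc (a - k) \<or> a - k = Suc (a - j)"
      using arm_adjacent[of "a - j" "a - k" s s] by (simp add: visited_arm_route)
    with 1 show ?thesis by linarith
  next
    case 2 with * aux[of j k] show ?thesis by (simp add: visited_arm_route)
  next
    case 3 with * aux[of k j] show ?thesis by (simp add: visited_arm_route adjacent_sym)
  next
    case 4
    with * have "j - a = Suc (k - a) \<or> k - a = Suc (j - a)"
      using arm_adjacent[of "j - a" "k - a" t t] by (simp add: visited_arm_route)
    with 4 show ?thesis by linarith
  qed
qed

end

section \<open>Serpentine arms\<close>

text \<open>The serpentine consists of blocks of four columns and \<open>2 * h + 4\<close> cells. In block \<open>b\<close> it runs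
along the axis to column \<open>4 * b + 2\<close>, up this column to height \<open>h\<close>, across column
\<open>4 * b + 3\<close> and down column \<open>4 * b + 4\<close>, where the axis cell belongs to the next block.
Columns \<open>0\<close> and \<open>1\<close> are met on the axis only, which leaves room for the other arms.\<close>

definition spine_x :: "nat \<Rightarrow> nat \<Rightarrow> nat" where
  "spine_x h i = 4 * (i div (2 * h + 4)) +
    (let r = i mod (2 * h + 4)
     in if r \<le> 1 then r else if r \<le> h + 2 then 2 else if r = h + 3 then 3 else 4)"

definition spine_y :: "nat \<Rightarrow> nat \<Rightarrow> nat" where
  "spine_y h i =
    (let r = i mod (2 * h + 4)
     in if r \<le> 1 then 0 else if r \<le> h + 2 then r - 2 else if r = h + 3 then h else 2 * h + 4 - r)"

definition spine_dir :: "nat \<Rightarrow> nat \<Rightarrow> side" where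
  "spine_dir h i =
    (let r = i mod (2 * h + 4)
     in if r \<le> 1 then Right else if r < h + 2 then Top else if r \<le> h + 3 then Right else Bottom)"

text \<open>All cells of the serpentine satisfy this; besides bounding the height it says that odd columns are
met in one cell only, at the bottom or at the top in turn.\<close>

definition spine_cell :: "nat \<Rightarrow> nat \<Rightarrow> nat \<Rightarrow> bool" where
  "spine_cell h x y \<longleftrightarrow> y \<le> h \<and> (x mod 4 = 1 \<longrightarrow> y = 0) \<and> (x mod 4 = 3 \<longrightarrow> y = h)"

text \<open>The inverse of the serpentine. Injectivity and absence of shortcuts follow from this formula:
a step to a neighbouring \<open>spine_cell\<close> changes it by exactly one.\<close>

definition spine_index :: "nat \<Rightarrow> nat \<Rightarrow> nat \<Rightarrow> int" where
  "spine_index h x y = int ((2 * h + 4) * (x div 4)) +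
    (if x mod 4 = 0 then - int y else if x mod 4 = 1 then 1
     else if x mod 4 = 2 then 2 + int y else int h + 3)"

lemma spine_div_mod_cases:
  obtains b r where "i = (2 * h + 4) * b + r" "r < 2 * h + 4" "i div (2 * h + 4) = b" "i mod (2 * h + 4) = (r :: nat)"
  using mult_div_mod_eq[of "2 * h + 4" i] by (metis mod_less_divisor add_gr_0 zero_less_numeral)

lemma spine_in_spine_cell: "spine_cell h (spine_x h i) (spine_y h i)"
proof -
  obtain b r where r: "r < 2 * h + 4" "i div (2 * h + 4) = b" "i mod (2 * h + 4) = r"
    by (rule spine_div_mod_cases)
  have "(4 * b + 1) mod 4 = 1" "(4 * b + 2) mod 4 = 2" "(4 * b + 3) mod 4 = 3" "(4 * b + 4) mod 4 = 0"
    by presburger+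
  then show ?thesis
    using r(1) by (auto simp: spine_cell_def spine_x_def spine_y_def r(2,3) Let_def le_Suc_eq)
qed

lemma spine_index_spine: "spine_index h (spine_x h i) (spine_y h i) = int i"
proof -
  obtain b r where i: "i = (2 * h + 4) * b + r" and r: "r < 2 * h + 4" "i div (2 * h + 4) = b" "i mod (2 * h + 4) = r"
    by (rule spine_div_mod_cases)
  have m: "(4 * b + 1) mod 4 = 1" "(4 * b + 2) mod 4 = 2" "(4 * b + 3) mod 4 = 3" "(4 * b + 4) mod 4 = 0"
    "(4 * b + 1) div 4 = b" "(4 * b + 2) div 4 = b" "(4 * b + 3) div 4 = b" "(4 * b + 4) div 4 = Suc b"
    by presburger+
  consider "r = 0" | "r = 1" | "2 \<le> r" "r \<le> h + 2" | "r = h + 3" | "h + 4 \<le> r" by linarith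
  then show ?thesis
  proof cases
    case 1 then have "spine_x h i = 4 * b" "spine_y h i = 0"
      by (simp_all add: spine_x_def spine_y_def r(2,3))
    with 1 show ?thesis by (simp add: spine_index_def i)
  next
    case 2 then have "spine_x h i = 4 * b + 1" "spine_y h i = 0"
      by (simp_all add: spine_x_def spine_y_def r(2,3))
    with 2 show ?thesis by (simp only: spine_index_def m) (simp add: i)
  next
    case 3 then have "spine_x h i = 4 * b + 2" "spine_y h i = r - 2"
      by (simp_all add: spine_x_def spine_y_def r(2,3))
    with 3 show ?thesis by (simp only: spine_index_def m) (simp add: i of_nat_diff)
  next
    case 4 then have "spine_x h i = 4 * b + 3" "spine_y h i = h"
      by (simp_all add: spine_x_def spine_y_def r(2,3))
    with 4 show ?thesis by (simp only: spine_index_def m) (simp add: i)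
  next
    case 5 then have "spine_x h i = 4 * b + 4" "spine_y h i = 2 * h + 4 - r"
      by (simp_all add: spine_x_def spine_y_def r(2,3))
    with 5 r(1) show ?thesis by (simp only: spine_index_def m) (simp add: i of_nat_diff algebra_simps)
  qed
qed

lemma spine_index_right:
  assumes "spine_cell h x y" "spine_cell h (Suc x) y"
  shows "spine_index h (Suc x) y = spine_index h x y + 1"
proof -
  consider b where "x = 4 * b" | b where "x = 4 * b + 1" | b where "x = 4 * b + 2" | b where "x = 4 * b + 3"
    using mod_exhaust_less_4[of x] mult_div_mod_eq[of 4 x] by (metis add.right_neutral)
  then show ?thesis
  proof cases
    case 1
    have m: "Suc x mod 4 = 1" "Suc x div 4 = b" "x mod 4 = 0" "x div 4 = b" unfolding 1 by presburger+
    with assms show ?thesis by (simp add: spine_index_def spine_cell_def)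
  next
    case 2
    have m: "Suc x mod 4 = 2" "Suc x div 4 = b" "x mod 4 = 1" "x div 4 = b" unfolding 2 by presburger+
    with assms show ?thesis by (simp add: spine_index_def spine_cell_def)
  next
    case 3
    have m: "Suc x mod 4 = 3" "Suc x div 4 = b" "x mod 4 = 2" "x div 4 = b" unfolding 3 by presburger+
    with assms show ?thesis by (simp add: spine_index_def spine_cell_def)
  next
    case 4
    have m: "Suc x mod 4 = 0" "Suc x div 4 = Suc b" "x mod 4 = 3" "x div 4 = b" unfolding 4 by presburger+
    with assms show ?thesis by (simp add: spine_index_def spine_cell_def)
  qed
qed

lemma spine_index_up:
  assumes "spine_cell h x y" "spine_cell h x (Suc y)"
  shows "\<bar>spine_index h x (Suc y) - spine_index h x y\<bar> = 1"
  using assms mod_exhaust_less_4[of x] by (auto simp: spine_index_def spine_cell_def)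

lemma spine_adjacent:
  assumes "adjacent (spine_x h i, spine_y h i) (spine_x h j, spine_y h j)"
  shows "i = Suc j \<or> j = Suc i"
proof -
  let ?x = "spine_x h" and ?y = "spine_y h"
  have near: "\<bar>spine_index h x y - spine_index h x' y'\<bar> = 1"
    if a: "adjacent (x, y) (x', y')" and c: "spine_cell h x y" "spine_cell h x' y'" for x y x' y'
  proof -
    consider "x' = x" "y' = Suc y" | "x' = x" "y = Suc y'" | "y' = y" "x' = Suc x" | "y' = y" "x = Suc x'"
      using a unfolding adjacent_def by auto
    then show ?thesis
      by cases (use c spine_index_up[of h x y] spine_index_up[of h x y']
        spine_index_right[of h x y] spine_index_right[of h x' y] in simp_all)
  qed
  have "\<bar>spine_index h (?x i) (?y i) - spine_index h (?x j) (?y j)\<bar> = 1"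
    by (rule near[OF assms spine_in_spine_cell spine_in_spine_cell])
  then show ?thesis unfolding spine_index_spine by linarith
qed

lemma spine_inj: "spine_x h i = spine_x h j \<Longrightarrow> spine_y h i = spine_y h j \<Longrightarrow> i = j"
  by (metis spine_index_spine of_nat_eq_iff)

lemma spine_0: "spine_x h 0 = 0" "spine_y h 0 = 0"
  by (simp_all add: spine_x_def spine_y_def)

text \<open>After \<open>q\<close> blocks the serpentine is on the axis in column \<open>4 * q\<close>, and one further step
makes it end by moving to the right.\<close>

lemma spine_tip:
  "spine_x h (q * (2 * h + 4) + 1) = 4 * q + 1" "spine_y h (q * (2 * h + 4) + 1) = 0"
  "spine_dir h (q * (2 * h + 4) + 1) = Right"
proof -
  have *: "(q * L + 1) div L = q \<and> (q * L + 1) mod L = 1" if "L > 1" for L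
    using that by (simp only: div_mult_self3 mod_mult_self3) simp
  have "(q * (2 * h + 4) + 1) div (2 * h + 4) = q" "(q * (2 * h + 4) + 1) mod (2 * h + 4) = 1"
    using *[of "2 * h + 4"] by simp_all
  then show "spine_x h (q * (2 * h + 4) + 1) = 4 * q + 1" "spine_y h (q * (2 * h + 4) + 1) = 0"
    "spine_dir h (q * (2 * h + 4) + 1) = Right"
    by (simp_all add: spine_x_def spine_y_def spine_dir_def)
qed

lemma spine_y_le: "spine_y h i \<le> h"
  using spine_in_spine_cell by (simp add: spine_cell_def)

lemma spine_x_eq_0: "spine_x h i = 0 \<Longrightarrow> i = 0"
  using spine_index_spine[of h i] by (simp add: spine_index_def)

lemma spine_off_axis: "spine_y h i > 0 \<Longrightarrow> spine_x h i \<ge> 2"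
proof (rule ccontr)
  assume *: "spine_y h i > 0" "\<not> spine_x h i \<ge> 2"
  then consider "spine_x h i = 0" | "spine_x h i = 1" by linarith
  then show False
    using * spine_x_eq_0[of h i] spine_0 spine_in_spine_cell[of h i] by cases (auto simp: spine_cell_def)
qed

lemma spine_x_le:
  assumes "i \<le> q * (2 * h + 4) + 1"
  shows "spine_x h i \<le> 4 * q + 1"
proof -
  obtain b r where i: "i = (2 * h + 4) * b + r" and r: "r < 2 * h + 4" "i div (2 * h + 4) = b" "i mod (2 * h + 4) = r"
    by (rule spine_div_mod_cases)
  show ?thesis
  proof (cases "b < q")
    case True
    then show ?thesis by (auto simp: spine_x_def r(2,3) Let_def)
  next
    case False
    then have "q * (2 * h + 4) \<le> b * (2 * h + 4)" by (intro mult_right_mono) auto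
    then have "r \<le> 1" using assms i by (simp add: algebra_simps)
    moreover have "b \<le> q"
    proof (rule ccontr)
      assume "\<not> b \<le> q"
      then have "Suc q * (2 * h + 4) \<le> b * (2 * h + 4)" by (intro mult_right_mono) auto
      then show False using assms i by (simp add: algebra_simps)
    qed
    ultimately show ?thesis by (simp add: spine_x_def r(2,3))
  qed
qed

lemma spine_x_eq_tip:
  assumes "spine_x h i = 4 * q + 1"
  shows "i = q * (2 * h + 4) + 1"
proof -
  have "(4 * q + 1) mod 4 = 1" by presburger
  then have "spine_y h i = 0" using spine_in_spine_cell[of h i] assms by (simp add: spine_cell_def)
  then show ?thesis using spine_inj[of h i "q * (2 * h + 4) + 1"] assms spine_tip by simp
qed

lemma spine_step: "neighbour (spine_dir h i) (spine_x h i, spine_y h i) (spine_x h (Suc i), spine_y h (Suc i))"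
proof -
  obtain b r where i: "i = (2 * h + 4) * b + r" and r: "r < 2 * h + 4" "i div (2 * h + 4) = b" "i mod (2 * h + 4) = r"
    by (rule spine_div_mod_cases)
  show ?thesis
  proof (cases "Suc r = 2 * h + 4")
    case True
    have s: "Suc i div (2 * h + 4) = Suc b" "Suc i mod (2 * h + 4) = 0"
      using True r by (auto simp: div_Suc mod_Suc)
    from True r(1) show ?thesis
      by (auto simp: spine_dir_def spine_x_def spine_y_def r(2,3) s Let_def)
  next
    case False
    have s: "Suc i div (2 * h + 4) = b" "Suc i mod (2 * h + 4) = Suc r"
      using False r by (auto simp: div_Suc mod_Suc)
    from False r(1) show ?thesis
      unfolding spine_dir_def spine_x_def spine_y_def r(2,3) s Let_def
      by (auto split: if_splits)
  qed
qed

text \<open>Rotates the first quadrant around the cell \<open>(p, p)\<close>, so that the positive axis points to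
the given side; \<open>turn\<close> is the same rotation applied to directions.\<close>

fun place :: "nat \<Rightarrow> side \<Rightarrow> cell \<Rightarrow> cell" where
  "place p Right (x, y) = (p + x, p + y)"
| "place p Top (x, y) = (p - y, p + x)"
| "place p Left (x, y) = (p - x, p - y)"
| "place p Bottom (x, y) = (p + y, p - x)"

fun turn :: "side \<Rightarrow> side \<Rightarrow> side" where
  "turn Right d = d"
| "turn Top d = (case d of Right \<Rightarrow> Top | Top \<Rightarrow> Left | Left \<Rightarrow> Bottom | Bottom \<Rightarrow> Right)"
| "turn Left d = opposite d"
| "turn Bottom d = (case d of Right \<Rightarrow> Bottom | Bottom \<Rightarrow> Left | Left \<Rightarrow> Top | Top \<Rightarrow> Right)"

lemma turn_Right: "turn s Right = s"
  by (cases s) auto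

lemma neighbour_place:
  assumes "neighbour d c c'" "fst c \<le> p" "snd c \<le> p" "fst c' \<le> p" "snd c' \<le> p"
  shows "neighbour (turn s d) (place p s c) (place p s c')"
  using assms by (cases c; cases c'; cases s; cases d) auto

lemma adjacent_place:
  assumes "adjacent (place p s c) (place p s c')" "fst c \<le> p" "snd c \<le> p" "fst c' \<le> p" "snd c' \<le> p"
  shows "adjacent c c'"
  using assms by (cases c; cases c'; cases s) (auto simp: adjacent_def)

lemma place_inj:
  assumes "place p s c = place p s c'" "fst c \<le> p" "snd c \<le> p" "fst c' \<le> p" "snd c' \<le> p"
  shows "c = c'"
  using assms by (cases c; cases c'; cases s) auto

text \<open>Two cells of neighbouring quadrants could be adjacent only across an axis, and the cells on either
side of it are kept apart by the hypotheses on the first two columns.\<close>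

lemma place_apart:
  assumes "s \<noteq> t"
    and "1 \<le> x" "x \<le> p" "y \<le> p" "0 < y \<longrightarrow> 2 \<le> x"
    and "1 \<le> x'" "x' \<le> p" "y' \<le> p" "0 < y' \<longrightarrow> 2 \<le> x'"
  shows "place p s (x, y) \<noteq> place p t (x', y')" "\<not> adjacent (place p s (x, y)) (place p t (x', y'))"
  using assms by (cases s; cases t; auto simp: adjacent_def)+

lemma place_on_side:
  assumes "on_side (2 * p + 1) d (place p s (x, y))" "x \<le> p" "y < p"
  shows "x = p \<and> d = s"
  using assms by (cases s; cases d) auto

definition serpentine_arm :: "nat \<Rightarrow> nat \<Rightarrow> side \<Rightarrow> nat \<Rightarrow> cell" where
  "serpentine_arm q h s i = place (4 * q + 1) s (spine_x h i, spine_y h i)"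

lemma four_serpentine_arms:
  assumes q: "q > 0" and h: "h \<le> 4 * q"
  shows "four_arms (8 * q + 3) (q * (2 * h + 4) + 1) (serpentine_arm q h) (\<lambda>s i. turn s (spine_dir h i))"
    (is "four_arms ?m ?a ?arm ?dir")
proof -
  let ?p = "4 * q + 1"
  have m: "?m = 2 * ?p + 1" by simp
  have x: "spine_x h i \<le> ?p" if "i \<le> ?a" for i using spine_x_le that by simp
  have y: "spine_y h i < ?p" for i using spine_y_le[of h i] h by simp
  have x1: "1 \<le> spine_x h i" if "i \<noteq> 0" for i using spine_x_eq_0[of h i] that by fastforce
  have arm_0: "?arm s 0 = ?arm t 0" for s t
    by (cases s; cases t) (simp_all add: serpentine_arm_def spine_0)
  have apart: "?arm s i \<noteq> ?arm t j \<and> \<not> adjacent (?arm s i) (?arm t j)"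
    if "s \<noteq> t" "i \<noteq> 0" "j \<noteq> 0" "i \<le> ?a" "j \<le> ?a" for s t i j
    using place_apart[OF that(1) x1[OF that(2)] x[OF that(4)] less_imp_le[OF y] _ x1[OF that(3)] x[OF that(5)] less_imp_le[OF y]]
      spine_off_axis by (simp add: serpentine_arm_def)
  show ?thesis
  proof
    show "?m \<ge> 3" by simp
    show "?arm s i \<in> {..<?m} \<times> {..<?m}" if "i \<le> ?a" for s i
      using x[OF that] y[of i] by (cases s) (auto simp: serpentine_arm_def)
    show "?arm s 0 = ?arm t 0" for s t by (rule arm_0)
    have "?m div 2 = ?p" "?m - 1 = 2 * ?p" by simp_all
    then show "?arm s ?a = middle ?m s" for s
      unfolding serpentine_arm_def spine_tip by (cases s) auto
    show "turn s (spine_dir h 0) = s" for s by (simp add: spine_dir_def turn_Right)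
    show "turn s (spine_dir h ?a) = s" for s unfolding spine_tip by (rule turn_Right)
    show "neighbour (turn s (spine_dir h i)) (?arm s i) (?arm s (Suc i))" if "i < ?a" for s i
      unfolding serpentine_arm_def
      by (rule neighbour_place[OF spine_step]) (use x[of i] x[of "Suc i"] y[of i] y[of "Suc i"] that in auto)
    show "i = ?a \<and> d = s" if "i \<le> ?a" "on_side ?m d (?arm s i)" for i d s
      using place_on_side[of ?p d s "spine_x h i" "spine_y h i"] that x[of i] y[of i] spine_x_eq_tip[of h i q]
      unfolding serpentine_arm_def m by blast
    have same_inj: "i = j" if "i \<le> ?a" "j \<le> ?a" "?arm s i = ?arm s j" for i j s
      using place_inj[of ?p s "(spine_x h i, spine_y h i)" "(spine_x h j, spine_y h j)"]
        that x[of i] x[of j] y[of i] y[of j] spine_inj[of h i j] unfolding serpentine_arm_def by auto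
    have same_adjacent: "i = Suc j \<or> j = Suc i" if "i \<le> ?a" "j \<le> ?a" "adjacent (?arm s i) (?arm s j)" for i j s
      using adjacent_place[of ?p s "(spine_x h i, spine_y h i)" "(spine_x h j, spine_y h j)"]
        that x[of i] x[of j] y[of i] y[of j] spine_adjacent[of h i j] unfolding serpentine_arm_def by auto
    show "i = j \<and> (i = 0 \<or> s = t)" if "i \<le> ?a" "j \<le> ?a" "?arm s i = ?arm t j" for i j s t
      using that same_inj[of i j s] same_inj[of i j t] apart[of s t i j] arm_0[of s t] by metis
    show "(i = Suc j \<or> j = Suc i) \<and> (i = 0 \<or> j = 0 \<or> s = t)"
      if "i \<le> ?a" "j \<le> ?a" "adjacent (?arm s i) (?arm t j)" for i j s t
      using that same_adjacent[of i j s] same_adjacent[of i j t] apart[of s t i j] arm_0[of s t] by metis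
  qed
qed

section \<open>Choice of the parameters\<close>

text \<open>The numerator differs from \<open>c\<close> times the denominator by at most \<open>n * ln C\<close>, and the
denominator is of order \<open>n\<^sup>2\<close>.\<close>

lemma ln_prod_asymp:
  fixes x :: "nat \<Rightarrow> nat" and c C :: real
  assumes x: "\<And>k. k \<ge> 1 \<Longrightarrow> 2 powr (c * k) \<le> x k \<and> x k \<le> C * 2 powr (c * k)" and C: "C \<ge> 1"
  shows "(\<lambda>n. ln (real (\<Prod>k=1..n. x k)) / (real n * (real n + 1) / 2 * ln 2)) \<longlonglongrightarrow> c"
proof -
  define T where "T n = real n * (real n + 1) / 2 * ln 2" for n :: nat
  have pos: "x k > 0" if "k \<ge> 1" for k
  proof -
    have "0 < 2 powr (c * k)" by simp
    with x[OF that] show ?thesis by linarith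
  qed
  have ln_x: "c * k * ln 2 \<le> ln (x k)" "ln (x k) \<le> c * k * ln 2 + ln C" if "k \<ge> 1" for k
  proof -
    have "ln (2 powr (c * k)) \<le> ln (x k)" using x[OF that] pos[OF that] by (subst ln_le_cancel_iff) auto
    then show "c * k * ln 2 \<le> ln (x k)" by (simp add: ln_powr)
    have "ln (x k) \<le> ln (C * 2 powr (c * k))" using x[OF that] pos[OF that] C by (subst ln_le_cancel_iff) auto
    then show "ln (x k) \<le> c * k * ln 2 + ln C" using C by (simp add: ln_mult ln_powr)
  qed
  have bounds: "c * T n \<le> ln (real (\<Prod>k=1..n. x k)) \<and> ln (real (\<Prod>k=1..n. x k)) \<le> c * T n + n * ln C" for n
  proof (induction n)
    case (Suc n)
    have "(\<Prod>k=1..n. x k) > 0" by (intro prod_pos) (auto intro: pos)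
    then have "ln (real (\<Prod>k=1..Suc n. x k)) = ln (real (\<Prod>k=1..n. x k)) + ln (real (x (Suc n)))"
      using pos[of "Suc n"] by (simp add: ln_mult del: of_nat_prod)
    moreover have "c * T (Suc n) = c * T n + c * real (Suc n) * ln 2"
      by (simp add: T_def field_simps)
    moreover have "real (Suc n) * ln C = n * ln C + ln C" by (simp add: algebra_simps)
    ultimately show ?case using Suc ln_x[of "Suc n"] by linarith
  qed (simp add: T_def)
  have ev: "\<forall>\<^sub>F n in sequentially. T n > 0"
    using eventually_gt_at_top[of 0] by eventually_elim (simp add: T_def)
  show ?thesis unfolding T_def[symmetric]
  proof (rule tendsto_sandwich)
    show "(\<lambda>_. c) \<longlonglongrightarrow> c" by simp
    have "(\<lambda>n. n * ln C / T n) \<longlonglongrightarrow> 0" unfolding T_def by real_asymp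
    then have "(\<lambda>n. c + n * ln C / T n) \<longlonglongrightarrow> c + 0" by (intro tendsto_intros)
    then show "(\<lambda>n. c + n * ln C / T n) \<longlonglongrightarrow> c" by simp
    show "\<forall>\<^sub>F n in sequentially. c \<le> ln (real (\<Prod>k=1..n. x k)) / T n"
      using ev by eventually_elim (use bounds in \<open>simp add: field_simps\<close>)
    show "\<forall>\<^sub>F n in sequentially. ln (real (\<Prod>k=1..n. x k)) / T n \<le> c + n * ln C / T n"
      using ev by eventually_elim (use bounds in \<open>simp add: field_simps\<close>)
  qed
qed

theorem theorem5:
  fixes \<delta> :: real
  assumes "\<delta> \<in> {1..2}"
  shows "\<exists>(m :: nat \<Rightarrow> nat) (A :: nat \<Rightarrow> cell set).
    (\<forall>k\<ge>1. labyrinth_pattern (m k) (A k)) \<and>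
    (\<forall>s t. s \<noteq> t \<longrightarrow>
      (\<exists>\<gamma>. arc \<gamma> \<and> path_image \<gamma> \<subseteq> limit_set m A \<and>
           pathstart \<gamma> = fractal_exit m A s \<and> pathfinish \<gamma> = fractal_exit m A t \<and>
           has_box_dimension (path_image \<gamma>) \<delta>))"
proof -
  define q h where "q k = (2::nat) ^ k" and "h k = nat \<lfloor>2 powr ((\<delta> - 1) * real k)\<rfloor>" for k
  define m a where "m k = 8 * q k + 3" and "a k = q k * (2 * h k + 4) + 1" for k
  define N where "N k = 2 * a k + 1" for k
  define arm dir where "arm k = serpentine_arm (q k) (h k)" and "dir k = (\<lambda>s i. turn s (spine_dir (h k) i))" for k
  have q: "real (q k) = 2 powr (real k)" for k by (simp add: q_def powr_realpow)
  have v: "1 \<le> 2 powr ((\<delta> - 1) * real k)" "2 powr ((\<delta> - 1) * real k) \<le> q k" for k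
  proof -
    have "2 powr 0 \<le> 2 powr ((\<delta> - 1) * real k)" using assms by (intro powr_mono) auto
    then show "1 \<le> 2 powr ((\<delta> - 1) * real k)" by simp
    show "2 powr ((\<delta> - 1) * real k) \<le> q k"
      unfolding q using assms by (intro powr_mono) (auto simp: mult_left_le_one_le)
  qed
  have h: "real (h k) \<le> 2 powr ((\<delta> - 1) * real k)" "2 powr ((\<delta> - 1) * real k) \<le> real (h k) + 1" for k
    using v(1)[of k] unfolding h_def by linarith+
  have arms: "four_arms (m k) (a k) (arm k) (dir k)" for k
  proof -
    have "q k > 0" by (simp add: q_def)
    moreover have "h k \<le> 4 * q k" using h(1)[of k] v(2)[of k] by linarith
    ultimately show ?thesis unfolding m_def a_def arm_def dir_def by (rule four_serpentine_arms)
  qed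
  define A where "A k = four_arms.cells (a k) (arm k)" for k
  define w where "w k = four_arms.arm_route (a k) (arm k) (dir k)" for k
  interpret crossing_patterns m A N w
  proof
    fix k :: nat and s t :: side and e
    interpret four_arms "m k" "a k" "arm k" "dir k" by (rule arms)
    show "odd (m k) \<and> m k \<ge> 3" by (simp add: m_def)
    show "A k \<subseteq> {..<m k} \<times> {..<m k}" unfolding A_def by (rule cells_in_grid)
    show "e = middle (m k) s" if "e \<in> A k" "on_side (m k) s e"
      using cells_on_side that unfolding A_def by blast
    show "route (m k) (A k) (N k) s t (w k s t)" if "s \<noteq> t"
      unfolding A_def N_def w_def by (rule route_arm_route[OF that])
  qed
  have T_pos: "\<forall>\<^sub>F n in sequentially. real n * (real n + 1) / 2 * ln 2 > 0"
    using eventually_gt_at_top[of 0] by eventually_elim simp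
  have ln_M: "(\<lambda>n. ln (real (M n)) / (real n * (real n + 1) / 2 * ln 2)) \<longlonglongrightarrow> 1"
    unfolding level_width_def
  proof (rule ln_prod_asymp)
    fix k :: nat
    have "real (q k) \<ge> 1" using v[of k] by linarith
    then show "2 powr (1 * real k) \<le> real (m k) \<and> real (m k) \<le> 11 * 2 powr (1 * real k)"
      using q[of k] by (simp add: m_def)
  qed simp
  have ln_P: "(\<lambda>n. ln (real (P n)) / (real n * (real n + 1) / 2 * ln 2)) \<longlonglongrightarrow> \<delta>"
    unfolding P_def
  proof (rule ln_prod_asymp)
    fix k :: nat
    let ?u = "real (q k)" and ?v = "2 powr ((\<delta> - 1) * real k)"
    (* Up to constant factors, N k is the number q k of columns times their height h k. *)
    have uv: "2 powr (\<delta> * real k) = ?u * ?v"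
      unfolding q powr_add[symmetric] by (simp add: algebra_simps)
    have N: "real (N k) = 4 * (?u * real (h k)) + 8 * ?u + 3"
      by (simp add: N_def a_def algebra_simps)
    have "?u * ?v \<le> ?u * (real (h k) + 1)" "?u * real (h k) \<le> ?u * ?v" "?u * 1 \<le> ?u * ?v" "1 \<le> ?u"
      using h v[of k] by (auto intro!: mult_left_mono)
    moreover have "?u * (real (h k) + 1) = ?u * real (h k) + ?u" by (simp add: algebra_simps)
    moreover have "0 \<le> ?u * real (h k)" by simp
    ultimately show "2 powr (\<delta> * real k) \<le> real (N k) \<and> real (N k) \<le> 15 * 2 powr (\<delta> * real k)"
      unfolding uv N by linarith
  qed simp
  have ratio: "(\<lambda>n. ln (real (M (Suc n))) / ln (real (M n))) \<longlonglongrightarrow> 1"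
  proof (rule Lim_transform_eventually)
    let ?T = "\<lambda>n. real n * (real n + 1) / 2 * ln 2"
    have "(\<lambda>n. ?T (Suc n) / ?T n) \<longlonglongrightarrow> 1" by real_asymp
    then have "(\<lambda>n. ln (real (M (Suc n))) / ?T (Suc n) * (?T (Suc n) / ?T n) / (ln (real (M n)) / ?T n)) \<longlonglongrightarrow> 1 * 1 / 1"
      by (intro tendsto_intros LIMSEQ_Suc[OF ln_M] ln_M) auto
    then show "(\<lambda>n. ln (real (M (Suc n))) / ?T (Suc n) * (?T (Suc n) / ?T n) / (ln (real (M n)) / ?T n)) \<longlonglongrightarrow> 1"
      by simp
    show "\<forall>\<^sub>F n in sequentially. ln (real (M (Suc n))) / ?T (Suc n) * (?T (Suc n) / ?T n) / (ln (real (M n)) / ?T n)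
        = ln (real (M (Suc n))) / ln (real (M n))"
      using T_pos T_pos[THEN filterlim_Suc[THEN eventually_compose_filterlim[rotated]]]
    proof eventually_elim
      case (elim n)
      have cancel: "x / b * (b / c) / (y / c) = x / y" if "b > 0" "c > 0" for x y b c :: real
        using that by (cases "y = 0") auto
      show ?case by (rule cancel[OF elim(2,1)])
    qed
  qed
  have dim: "(\<lambda>n. ln (real (P n)) / ln (real (M n))) \<longlonglongrightarrow> \<delta>"
  proof (rule Lim_transform_eventually)
    let ?T = "\<lambda>n. real n * (real n + 1) / 2 * ln 2"
    show "(\<lambda>n. (ln (real (P n)) / ?T n) / (ln (real (M n)) / ?T n)) \<longlonglongrightarrow> \<delta>"
      using tendsto_divide[OF ln_P ln_M] by simp
    show "\<forall>\<^sub>F n in sequentially. (ln (real (P n)) / ?T n) / (ln (real (M n)) / ?T n) = ln (real (P n)) / ln (real (M n))"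
      using eventually_gt_at_top[of 0] by eventually_elim simp
  qed
  have labyrinth: "labyrinth_pattern (m k) (A k)" for k
    unfolding A_def by (rule four_arms.labyrinth_cells[OF arms])
  have arcs: "\<exists>\<gamma>. arc \<gamma> \<and> path_image \<gamma> \<subseteq> limit_set m A \<and>
      pathstart \<gamma> = fractal_exit m A s \<and> pathfinish \<gamma> = fractal_exit m A t \<and>
      has_box_dimension (path_image \<gamma>) \<delta>" if "s \<noteq> t" for s t
  proof -
    interpret fractal_route m A N w s t by unfold_locales (rule that)
    have card: "card (trail_cell n ` {..<P n}) = P n" for n
      using trail_cell_inj[of n] by (simp add: card_image)
    have "has_box_dimension (path_image \<gamma>) \<delta>"
    proof (rule has_box_dimension_grid)
      show "(\<lambda>n. ln (real (card (trail_cell n ` {..<P n}))) / ln (real (M n))) \<longlonglongrightarrow> \<delta>"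
        unfolding card by (rule dim)
    qed (use M_pos P_pos mono_M M_at_top \<gamma>_covered \<gamma>_meets ratio in
        \<open>auto simp: lessThan_empty_iff\<close>)
    then show ?thesis using arc_\<gamma> \<gamma>_in_limit_set \<gamma>_start \<gamma>_finish by blast
  qed
  show ?thesis using labyrinth arcs by blast
qed

end
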